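(* For the generic continuous function $f\in C(\Omega)$, the spectrum $S_f$ is continuous on $\mathbb R$. That is, the set of $f\in C(\Omega)$ for which $S_f:\mathbb R\to\mathbb R$ is not continuous is of first category in $C(\Omega)$.
   Context: $\Omega=\{0,1\}^{\mathbb N}$ ($\mathbb N=\{1,2,\dots\}$) with the metric $d(\omega,\omega')=\sum_{k\ge1}|\omega_k-\omega'_k|2^{-k}$; $\sigma:\Omega\to\Omega$ is the one-sided shift, $(\sigma\omega)_k=\omega_{k+1}$. $C(\Omega)$ is the space of continuous functions $\Omega\to\mathbb R$ with the supremum norm. A property holds for the generic $f\in C(\Omega)$ if the set of $f$ having it is the complement of a set of first category (a countable union of nowhere dense sets) in $C(\Omega)$. For $f\in C(\Omega)$ and $\alpha\in\mathbb R$, $E_f(\alpha)=\{\omega\in\Omega:\lim_{N\to\infty}\frac1N\sum_{n=1}^N f(\sigma^n\omega)=\alpha\}$ and the Birkhoff spectrum is $S_f:\mathbb R\to[0,1]$, $S_f(\alpha)=\dim_H E_f(\alpha)$ (Hausdorff dimension with respect to $d$; $\dim_H\emptyset=0$). *)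

theory Defs
  imports "HOL-Analysis.Analysis"
begin

section \<open>Baire category\<close>

definition nowhere_dense :: "'a::topological_space set \<Rightarrow> bool" where
  "nowhere_dense S \<longleftrightarrow> interior (closure S) = {}"

definition first_category :: "'a::topological_space set \<Rightarrow> bool" where
  "first_category S \<longleftrightarrow> (\<exists>T :: nat \<Rightarrow> 'a set. (\<forall>n. nowhere_dense (T n)) \<and> S = (\<Union>n. T n))"


section \<open>Hausdorff dimension\<close>

text \<open>Boundedness of the covering sets is required because \<^const>\<open>diameter\<close> is an unspecified
  real number on unbounded sets. Countable covers include the finite ones, since \<open>U i\<close> may be empty
  and \<^const>\<open>diameter\<close> vanishes on the empty set.\<close>

definition hausdorff_premeasure :: "real \<Rightarrow> real \<Rightarrow> 'a::metric_space set \<Rightarrow> ennreal" where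
  "hausdorff_premeasure s \<delta> A =
     (INF U \<in> {U :: nat \<Rightarrow> 'a set. A \<subseteq> (\<Union>i. U i) \<and> (\<forall>i. bounded (U i) \<and> diameter (U i) \<le> \<delta>)}.
        \<Sum>i. ennreal (diameter (U i) powr s))"

definition hausdorff_measure :: "real \<Rightarrow> 'a::metric_space set \<Rightarrow> ennreal" where
  "hausdorff_measure s A = (SUP \<delta> \<in> {0<..}. hausdorff_premeasure s \<delta> A)"

text \<open>Only exponents \<open>s > 0\<close> are used, which does not affect the infimum and avoids the
  convention for \<open>0 powr 0\<close>. The infimum over the empty set is \<open>\<infinity>\<close>; the empty set has
  dimension \<open>0\<close>.\<close>

definition hausdorff_dim :: "'a::metric_space set \<Rightarrow> ennreal" where
  "hausdorff_dim A = (INF s \<in> {s :: real. s > 0 \<and> hausdorff_measure s A = 0}. ennreal s)"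


section \<open>The space of binary sequences\<close>

text \<open>The digits \<open>0\<close>, \<open>1\<close> are \<^const>\<open>False\<close>, \<^const>\<open>True\<close>, and the coordinate written
  \<open>\<omega>\<^sub>k\<close> with \<open>k \<ge> 1\<close> is \<open>digit \<omega> (k - 1)\<close>, hence the weights \<open>1 / 2 ^ Suc k\<close> below. A separate type
  is used since function types already carry a different metric.\<close>

typedef binseq = "UNIV :: (nat \<Rightarrow> bool) set"
  morphisms digit Binseq
  by simp

setup_lifting type_definition_binseq

lift_definition shift :: "binseq \<Rightarrow> binseq" is "\<lambda>\<omega> k. \<omega> (Suc k)" .

lemma digit_Binseq [simp]: "digit (Binseq w) = w"
  by (simp add: Binseq_inverse)

lemma digit_shift [simp]: "digit (shift w) k = digit w (Suc k)"
  by transfer simp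

lemma binseq_eq_iff: "x = y \<longleftrightarrow> (\<forall>k. digit x k = digit y k)"
  by (simp add: fun_eq_iff flip: digit_inject)

lemma summable_binseq_dist:
  "summable (\<lambda>k. \<bar>of_bool (a k) - of_bool (b k)\<bar> / 2 ^ Suc k :: real)"
proof (rule summable_comparison_test'[of "\<lambda>k. (1/2)^k"])
  show "summable (\<lambda>k. (1/2::real) ^ k)"
    by (simp add: summable_geometric_iff)
qed (auto simp: power_one_over field_simps of_bool_def)

instantiation binseq :: metric_space
begin

definition dist_binseq :: "binseq \<Rightarrow> binseq \<Rightarrow> real" where
  "dist_binseq x y = (\<Sum>k. \<bar>of_bool (digit x k) - of_bool (digit y k)\<bar> / 2 ^ Suc k)"

definition uniformity_binseq :: "(binseq \<times> binseq) filter" where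
  "uniformity_binseq = (INF e\<in>{0<..}. principal {(x, y). dist x y < e})"

definition open_binseq :: "binseq set \<Rightarrow> bool" where
  "open_binseq S \<longleftrightarrow> (\<forall>x\<in>S. \<forall>\<^sub>F (x', y) in uniformity. x' = x \<longrightarrow> y \<in> S)"

instance
proof
  fix x y z :: binseq
  have "dist x y = 0 \<longleftrightarrow>
      (\<forall>k. \<bar>of_bool (digit x k) - of_bool (digit y k)\<bar> / 2 ^ Suc k = (0::real))"
    unfolding dist_binseq_def
    by (rule suminf_eq_zero_iff[OF summable_binseq_dist]) simp
  also have "\<dots> \<longleftrightarrow> (\<forall>k. digit x k = digit y k)"
    by (auto simp: of_bool_def split: if_splits)
  finally show "dist x y = 0 \<longleftrightarrow> x = y"
    by (simp add: binseq_eq_iff)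
  have "dist x y \<le> (\<Sum>k. \<bar>of_bool (digit x k) - of_bool (digit z k)\<bar> / 2 ^ Suc k
                    + \<bar>of_bool (digit y k) - of_bool (digit z k)\<bar> / 2 ^ Suc k)"
    unfolding dist_binseq_def
  proof (rule suminf_le)
    show "\<bar>of_bool (digit x k) - of_bool (digit y k)\<bar> / 2 ^ Suc k
        \<le> \<bar>of_bool (digit x k) - of_bool (digit z k)\<bar> / 2 ^ Suc k
          + \<bar>of_bool (digit y k) - of_bool (digit z k)\<bar> / (2 ^ Suc k :: real)" for k
      by (auto simp: of_bool_def)
  qed (intro summable_add summable_binseq_dist)+
  also have "\<dots> = dist x z + dist y z"
    unfolding dist_binseq_def
    by (rule suminf_add[symmetric]) (rule summable_binseq_dist)+
  finally show "dist x y \<le> dist x z + dist y z" .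
qed (simp_all add: uniformity_binseq_def open_binseq_def)

end

lemma dist_binseq_le:
  assumes "\<And>k. k < n \<Longrightarrow> digit x k = digit y k"
  shows "dist x y \<le> 1 / 2 ^ n"
proof -
  let ?g = "\<lambda>k. (if k < n then 0 else 1 / 2 ^ Suc k) :: real"
  have *: "(\<lambda>k. ?g (k + n)) sums (1 / 2 ^ n)"
  proof -
    have "(\<lambda>k. (1 / 2 ^ n) * (1 / 2) ^ Suc k) sums ((1 / 2 ^ n) * (1::real))"
      by (rule sums_mult) (rule power_half_series)
    thus ?thesis
      by (simp add: power_add field_simps)
  qed
  have "?g sums (1 / 2 ^ n + (\<Sum>i<n. ?g i))"
    using * by (subst (asm) sums_iff_shift) simp
  hence g: "?g sums (1 / 2 ^ n)" by simp
  have "dist x y \<le> suminf ?g"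
    unfolding dist_binseq_def
    by (rule suminf_le) (use assms sums_summable[OF g] summable_binseq_dist in \<open>auto simp: of_bool_def\<close>)
  with g show ?thesis by (simp add: sums_iff)
qed


section \<open>Birkhoff spectrum\<close>

text \<open>The space \<open>C(\<Omega>)\<close> is the type \<open>binseq \<Rightarrow>\<^sub>C real\<close> with its supremum metric: as the sequence
  space is compact, the boundedness built into this type is automatic.\<close>

lemma compact_binseq: "compact (UNIV :: binseq set)"
proof -
  have "compactin (product_topology (\<lambda>_::nat. euclidean :: bool topology) UNIV)
          (PiE UNIV (\<lambda>_. UNIV))"
    by (subst compactin_PiE) (auto intro: finite_imp_compact)
  hence "compact (UNIV :: (nat \<Rightarrow> bool) set)"
    by (simp add: euclidean_product_topology)
  moreover have "continuous_on UNIV Binseq"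
    unfolding continuous_on_def
  proof (intro ballI tendstoI)
    fix w :: "nat \<Rightarrow> bool" and e :: real
    assume "e > 0"
    then obtain n where n: "1 / 2 ^ n < e"
      using real_arch_pow_inv[of e "1/2"] by (auto simp: power_one_over)
    have "\<forall>\<^sub>F v in at w. v k = w k" for k
    proof -
      have "open {v. v k \<in> {w k}}"
        using open_vimage[OF open_discrete[of "{w k}"] continuous_on_product_coordinates[of k]]
        by (simp add: vimage_def)
      thus ?thesis
        by (intro eventually_at_topological[THEN iffD2]) (auto intro!: exI[of _ "{v. v k \<in> {w k}}"])
    qed
    hence "\<forall>\<^sub>F v in at w. \<forall>k\<in>{..<n}. v k = w k"
      by (intro eventually_ball_finite) auto
    thus "\<forall>\<^sub>F v in at w. dist (Binseq v) (Binseq w) < e"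
    proof eventually_elim
      case (elim v)
      have "dist (Binseq v) (Binseq w) \<le> 1 / 2 ^ n"
        by (rule dist_binseq_le) (use elim in auto)
      with n show ?case by simp
    qed
  qed
  ultimately have "compact (range Binseq)"
    by (rule compact_continuous_image[rotated])
  moreover have "range Binseq = UNIV"
    by (metis digit_inverse surj_def)
  ultimately show ?thesis by simp
qed

lemma bcontfun_binseq_iff:
  fixes f :: "binseq \<Rightarrow> real"
  shows "f \<in> bcontfun \<longleftrightarrow> continuous_on UNIV f"
  by (auto simp: bcontfun_def intro!: compact_imp_bounded compact_continuous_image compact_binseq)

definition birkhoff_level :: "(binseq \<Rightarrow>\<^sub>C real) \<Rightarrow> real \<Rightarrow> binseq set" where
  "birkhoff_level f \<alpha> =
     {\<omega>. (\<lambda>N. (1 / real N) * (\<Sum>n=1..N. apply_bcontfun f ((shift ^^ n) \<omega>))) \<longlonglongrightarrow> \<alpha>}"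

text \<open>The conversion to \<^typ>\<open>real\<close> loses nothing: every set of binary sequences has Hausdorff
  dimension at most \<open>1\<close>.\<close>

lemma hausdorff_dim_binseq_le_1: "hausdorff_dim (A :: binseq set) \<le> 1"
proof -
  have null: "hausdorff_measure s A = 0" if s: "s > 1" for s
  proof -
    have "hausdorff_premeasure s \<delta> A \<le> 0" if "\<delta> > 0" for \<delta>
    proof -
      obtain n0 where n0: "1 / 2 ^ n0 < \<delta>"
        using real_arch_pow_inv[of \<delta> "1/2"] \<open>\<delta> > 0\<close> by (auto simp: power_one_over)
      have bound: "hausdorff_premeasure s \<delta> A \<le> ennreal ((2 powr (1 - s)) ^ n)" if "n \<ge> n0" for n
      proof -
        define U where "U = (\<lambda>i::nat. if i < 2 ^ n then {w. \<forall>k<n. digit w k = bit i k} else {})"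
        have dU: "dist x y \<le> 1 / 2 ^ n" if "x \<in> U i" "y \<in> U i" for x y i
          using that by (intro dist_binseq_le) (auto simp: U_def split: if_splits)
        have diam: "diameter (U i) \<le> 1 / 2 ^ n" for i
          unfolding diameter_def by (auto intro!: cSUP_least dU)
        have bd: "bounded (U i)" for i
          unfolding bounded_def using dU by blast
        have "1 / 2 ^ n \<le> (1 / 2 ^ n0 :: real)"
          using that by (simp add: frac_le)
        hence "diameter (U i) \<le> \<delta>" for i
          using diam[of i] n0 by linarith
        moreover have "A \<subseteq> (\<Union>i. U i)"
        proof
          fix w
          define i :: nat where "i = take_bit n (horner_sum of_bool 2 (map (digit w) [0..<n]))"
          have "i < 2 ^ n" by (simp add: i_def)
          moreover have "\<forall>k<n. bit i k = digit w k"
            by (auto simp: i_def bit_take_bit_iff bit_horner_sum_bit_iff)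
          ultimately have "w \<in> U i" by (simp add: U_def)
          thus "w \<in> (\<Union>i. U i)" by blast
        qed
        ultimately have "hausdorff_premeasure s \<delta> A \<le> (\<Sum>i. ennreal (diameter (U i) powr s))"
          unfolding hausdorff_premeasure_def using bd by (intro INF_lower) auto
        also have "\<dots> = (\<Sum>i<2^n. ennreal (diameter (U i) powr s))"
          by (rule suminf_finite) (auto simp: U_def)
        also have "\<dots> \<le> (\<Sum>i<(2::nat)^n. ennreal ((1 / 2 ^ n) powr s))"
          using s diam bd by (intro sum_mono ennreal_leI powr_mono2) (auto simp: diameter_ge_0)
        also have "\<dots> = ennreal (2 ^ n * (1 / 2 ^ n) powr s)"
          by (simp add: ennreal_mult ennreal_power flip: ennreal_numeral)
        also have "2 ^ n * (1 / 2 ^ n) powr s = (2 powr (1 - s)) ^ n"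
        proof -
          have "(1 / 2 ^ n) powr s = 2 powr (- real n * s)"
            by (simp add: powr_minus_divide powr_divide powr_powr flip: powr_realpow)
          moreover have "(2::real) ^ n = 2 powr real n" "(2 powr (1 - s)) ^ n = 2 powr ((1 - s) * real n)"
            by (simp_all add: powr_realpow powr_power mult.commute)
          ultimately show ?thesis
            by (simp add: algebra_simps flip: powr_add)
        qed
        finally show ?thesis .
      qed
      have "2 powr (1 - s) < (1::real)"
        using s powr_less_mono[of "1 - s" 0 2] by simp
      hence "(\<lambda>n. (2 powr (1 - s)) ^ n) \<longlonglongrightarrow> (0::real)"
        by (intro LIMSEQ_realpow_zero) auto
      hence "(\<lambda>n. ennreal ((2 powr (1 - s)) ^ n)) \<longlonglongrightarrow> ennreal 0"
        by (rule tendsto_ennrealI)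
      thus ?thesis
        using bound by (intro LIMSEQ_le_const) auto
    qed
    thus ?thesis
      unfolding hausdorff_measure_def by (simp add: SUP_eq_iff bot_ennreal)
  qed
  have dim: "hausdorff_dim A \<le> ennreal s" if "s > 1" for s
    unfolding hausdorff_dim_def using null[OF that] that by (intro INF_lower) auto
  have "hausdorff_dim A \<le> ennreal (1 + 1 / real (Suc n))" for n
    by (rule dim) simp
  moreover have "(\<lambda>n. ennreal (1 + 1 / real (Suc n))) \<longlonglongrightarrow> ennreal (1 + 0)"
    by (intro tendsto_ennrealI tendsto_add tendsto_const LIMSEQ_Suc lim_1_over_n)
  ultimately show ?thesis
    using LIMSEQ_le_const by fastforce
qed

definition birkhoff_spectrum :: "(binseq \<Rightarrow>\<^sub>C real) \<Rightarrow> real \<Rightarrow> real" where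
  "birkhoff_spectrum f \<alpha> = enn2real (hausdorff_dim (birkhoff_level f \<alpha>))"

end

theory Submission
  imports Defs
begin

text \<open>Let \<open>L\<close> be the set of attainable averages \<open>\<alpha>\<close>. Counting the words whose Birkhoff averages are
  close to \<open>\<alpha>\<close> gives an exponential growth rate. Covers by cylinders bound the dimension of the level
  set from above by this rate, and a Hoelder embedding of the full shift, built by concatenating ever
  longer good words, bounds it from below. Since words of two kinds can be mixed in any proportion,
  the spectrum is concave on the closed interval \<open>L\<close>, hence continuous in its interior, and it
  vanishes outside \<open>L\<close>. For arbitrary \<open>f\<close> it can only be discontinuous at the two end points.

  For generic \<open>f\<close> it tends to \<open>0\<close> there. Indeed, let \<open>p\<close> be a period of a periodic point that nearly
  maximizes the average of \<open>f\<close>, and add to \<open>f\<close> a small multiple \<open>c\<close> of the indicator of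
  \<open>\<omega>\<^sub>0 = \<omega>\<^sub>p\<close>. As \<open>c\<close> does not depend on how nearly the point is maximizing, every nearly maximizing
  orbit of the new function satisfies \<open>\<omega>\<^sub>k = \<omega>\<^sub>k\<^sub>+\<^sub>p\<close> for most \<open>k\<close>, so it is determined by its first \<open>p\<close>
  digits and a sparse set of exceptional times; there are few such sets. All this persists under
  small perturbations. The other end point is treated by passing to \<open>-f\<close>.\<close>

section \<open>Words and their growth rates\<close>

lemma digit_shift_funpow [simp]: "digit ((shift ^^ i) w) k = digit w (i + k)"
  by (induction i arbitrary: k) simp_all

definition pre :: "nat \<Rightarrow> binseq \<Rightarrow> bool list" where
  "pre n w = map (digit w) [0..<n]"

lemma length_pre [simp]: "length (pre n w) = n"
  by (simp add: pre_def)

lemma nth_pre [simp]: "k < n \<Longrightarrow> pre n w ! k = digit w k"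
  by (simp add: pre_def)

lemma pre_eq_iff: "pre n w = pre n v \<longleftrightarrow> (\<forall>k<n. digit w k = digit v k)"
  by (auto simp: list_eq_iff_nth_eq)

lemma pre_add: "pre (n + m) w = pre n w @ pre m ((shift ^^ n) w)"
  by (auto simp: list_eq_iff_nth_eq nth_append)

lemma finite_range_pre: "finite (pre n ` A)"
  by (rule finite_subset[OF _ finite_lists_length_eq[of UNIV n]]) auto

lemma dist_binseq_ge:
  assumes "digit x k \<noteq> digit y k"
  shows "1 / 2 ^ Suc k \<le> dist x y"
proof -
  have "(\<Sum>i\<in>{k}. \<bar>of_bool (digit x i) - of_bool (digit y i)\<bar> / 2 ^ Suc i :: real) \<le> dist x y"
    unfolding dist_binseq_def by (rule sum_le_suminf[OF summable_binseq_dist]) auto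
  thus ?thesis using assms by (auto simp: of_bool_def split: if_splits)
qed

definition bsum :: "(binseq \<Rightarrow> real) \<Rightarrow> nat \<Rightarrow> binseq \<Rightarrow> real" where
  "bsum f n w = (\<Sum>i<n. f ((shift ^^ i) w))"

lemma bsum_add: "bsum f (n + m) w = bsum f n w + bsum f m ((shift ^^ n) w)"
proof -
  have "sum (\<lambda>i. f ((shift ^^ i) w)) {..<n + m}
      = sum (\<lambda>i. f ((shift ^^ i) w)) {..<n} + sum (\<lambda>i. f ((shift ^^ i) w)) {n..<n + m}"
    by (simp add: sum.atLeastLessThan_concat lessThan_atLeast0)
  also have "sum (\<lambda>i. f ((shift ^^ i) w)) {n..<n + m} = (\<Sum>i<m. f ((shift ^^ i) ((shift ^^ n) w)))"
    using sum.shift_bounds_nat_ivl[of "\<lambda>i. f ((shift ^^ i) w)" 0 n m]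
    by (simp add: lessThan_atLeast0 funpow_add add.commute)
  finally show ?thesis by (simp add: bsum_def)
qed

lemma abs_bsum_le:
  assumes "\<And>w. \<bar>f w\<bar> \<le> B"
  shows "\<bar>bsum f n w\<bar> \<le> n * B"
proof -
  have "\<bar>bsum f n w\<bar> \<le> (\<Sum>i<n. \<bar>f ((shift ^^ i) w)\<bar>)"
    unfolding bsum_def by (rule sum_abs)
  also have "\<dots> \<le> of_nat (card {..<n}) * B"
    by (rule sum_bounded_above) (use assms in auto)
  finally show ?thesis by simp
qed

text \<open>Summing over the times 1 to N instead of 0 to N - 1 changes the sum by two boundary
  terms only, which vanish after division by N.\<close>

lemma birkhoff_level_altdef:
  "birkhoff_level f \<alpha> = {w. (\<lambda>n. bsum (apply_bcontfun f) n w / n) \<longlonglongrightarrow> \<alpha>}"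
proof -
  have B: "\<bar>apply_bcontfun f w\<bar> \<le> norm f" for w
    using norm_bounded[of f w] by simp
  have "(\<lambda>N. (1 / real N) * (\<Sum>n=1..N. apply_bcontfun f ((shift ^^ n) w))
           - bsum (apply_bcontfun f) N w / N) \<longlonglongrightarrow> 0" for w
  proof (rule Lim_null_comparison)
    have *: "(\<Sum>n=1..N. apply_bcontfun f ((shift ^^ n) w))
        = bsum (apply_bcontfun f) N w + (apply_bcontfun f ((shift ^^ N) w) - apply_bcontfun f w)" for N
      by (induction N) (auto simp: bsum_def)
    show "\<forall>\<^sub>F N in sequentially. norm ((1 / real N) * (\<Sum>n=1..N. apply_bcontfun f ((shift ^^ n) w))
           - bsum (apply_bcontfun f) N w / N) \<le> 2 * norm f / N"
    proof (rule always_eventually, rule allI)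
      fix N
      have "\<bar>apply_bcontfun f ((shift ^^ N) w) - apply_bcontfun f w\<bar> \<le> 2 * norm f"
        using B[of w] B[of "(shift ^^ N) w"] by linarith
      hence "\<bar>apply_bcontfun f ((shift ^^ N) w) - apply_bcontfun f w\<bar> / N \<le> 2 * norm f / N"
        by (rule divide_right_mono) simp
      thus "norm ((1 / real N) * (\<Sum>n=1..N. apply_bcontfun f ((shift ^^ n) w))
           - bsum (apply_bcontfun f) N w / N) \<le> 2 * norm f / N"
        unfolding * by (simp add: add_divide_distrib flip: diff_divide_distrib)
    qed
    show "(\<lambda>N. 2 * norm f / N) \<longlonglongrightarrow> 0"
      by (rule lim_const_over_n)
  qed
  note Lim = Lim_transform_eq[OF this]
  thus ?thesis
    unfolding birkhoff_level_def by auto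
qed

lemma bounded_on_binseq:
  fixes f :: "binseq \<Rightarrow> real"
  assumes "continuous_on UNIV f"
  shows "\<exists>B>0. \<forall>w. \<bar>f w\<bar> \<le> B"
proof -
  have "bounded (range f)"
    by (rule compact_imp_bounded[OF compact_continuous_image[OF assms compact_binseq]])
  thus ?thesis by (auto simp: bounded_pos)
qed

text \<open>Uniform continuity handles all times except a fixed number k of final ones, where few
  common digits remain; those cost at most \<open>2 * B\<close> each, which is negligible against
  n.\<close>

lemma bsum_distortion:
  assumes f: "continuous_on UNIV f" and "\<epsilon> > 0"
  shows "\<exists>N. \<forall>n\<ge>N. \<forall>w v. pre n w = pre n v \<longrightarrow> \<bar>bsum f n w - bsum f n v\<bar> \<le> real n * \<epsilon>"
proof -
  obtain B where B: "B > 0" "\<And>w. \<bar>f w\<bar> \<le> B"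
    using bounded_on_binseq[OF f] by blast
  have "uniformly_continuous_on UNIV f"
    by (rule compact_uniformly_continuous[OF f compact_binseq])
  hence "\<exists>d>0. \<forall>w\<in>UNIV. \<forall>v\<in>UNIV. dist v w < d \<longrightarrow> dist (f v) (f w) < \<epsilon> / 2"
    unfolding uniformly_continuous_on_def using \<open>\<epsilon> > 0\<close> by (elim allE[of _ "\<epsilon> / 2"]) simp
  then obtain d where d: "d > 0" "\<And>w v. dist v w < d \<Longrightarrow> dist (f v) (f w) < \<epsilon> / 2"
    by blast
  obtain k where k: "1 / 2 ^ k < d"
    using real_arch_pow_inv[of d "1/2"] d by (auto simp: power_one_over)
  obtain N :: nat where N: "2 * B * k \<le> N * (\<epsilon> / 2)"
    using real_arch_simple[of "2 * B * k / (\<epsilon> / 2)"] \<open>\<epsilon> > 0\<close> by (auto simp: field_simps)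
  show ?thesis
  proof (intro exI[of _ N] allI impI)
    fix n w v assume n: "n \<ge> N" and wv: "pre n w = pre n v"
    have *: "\<bar>f ((shift ^^ i) w) - f ((shift ^^ i) v)\<bar> \<le> \<epsilon> / 2 + (if n - k \<le> i then 2 * B else 0)"
      if "i < n" for i
    proof (cases "n - k \<le> i")
      case True
      thus ?thesis using B(2)[of "(shift ^^ i) w"] B(2)[of "(shift ^^ i) v"] \<open>\<epsilon> > 0\<close> by simp
    next
      case False
      \<comment> \<open>At a time \<open>i < n - k\<close> the shifted points still share at least k
        digits.\<close>
      have "dist ((shift ^^ i) w) ((shift ^^ i) v) \<le> 1 / 2 ^ k"
        by (rule dist_binseq_le) (use False wv in \<open>auto simp: pre_eq_iff\<close>)
      thus ?thesis using d(2)[of "(shift ^^ i) w" "(shift ^^ i) v"] k False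
        by (simp add: dist_real_def)
    qed
    have "\<bar>bsum f n w - bsum f n v\<bar> \<le> (\<Sum>i<n. \<bar>f ((shift ^^ i) w) - f ((shift ^^ i) v)\<bar>)"
      unfolding bsum_def sum_subtractf[symmetric] by (rule sum_abs)
    also have "\<dots> \<le> (\<Sum>i<n. \<epsilon> / 2 + (if n - k \<le> i then 2 * B else 0))"
      by (intro sum_mono *) auto
    also have "\<dots> = n * (\<epsilon> / 2) + 2 * B * card {i\<in>{..<n}. n - k \<le> i}"
      by (simp add: sum.distrib flip: sum.inter_filter)
    also have "{i\<in>{..<n}. n - k \<le> i} = {n - k..<n}" by auto
    also have "n * (\<epsilon> / 2) + 2 * B * card {n - k..<n} \<le> n * (\<epsilon> / 2) + 2 * B * k"
      using B(1) by simp
    also have "\<dots> \<le> n * (\<epsilon> / 2) + N * (\<epsilon> / 2)" using N by simp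
    also have "\<dots> \<le> n * (\<epsilon> / 2) + n * (\<epsilon> / 2)" using n \<open>\<epsilon> > 0\<close>
      by (intro add_left_mono mult_right_mono) auto
    finally show "\<bar>bsum f n w - bsum f n v\<bar> \<le> n * \<epsilon>" by (simp add: algebra_simps)
  qed
qed

text \<open>The bound is required for every sequence extending the word, so it is a property of the
  word alone. Concatenation then adds the errors exactly, with no distortion term at the
  joints.\<close>

definition rich :: "(binseq \<Rightarrow> real) \<Rightarrow> nat \<Rightarrow> real \<Rightarrow> real \<Rightarrow> real \<Rightarrow> bool" where
  "rich f n a e q \<longleftrightarrow> (\<exists>W. (\<forall>u\<in>W. length u = n \<and> (\<forall>w. pre n w = u \<longrightarrow> \<bar>bsum f n w - a\<bar> \<le> e))
                        \<and> 2 powr q \<le> card W)"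

lemma rich_mono:
  assumes "rich f n a e q" "\<bar>a - a'\<bar> + e \<le> e'" "q' \<le> q"
  shows "rich f n a' e' q'"
proof -
  obtain W where W: "\<And>u w. u \<in> W \<Longrightarrow> length u = n \<and> (pre n w = u \<longrightarrow> \<bar>bsum f n w - a\<bar> \<le> e)"
     "2 powr q \<le> card W"
    using assms(1) unfolding rich_def by blast
  show ?thesis
    unfolding rich_def
  proof (intro exI[of _ W] conjI ballI allI impI)
    fix u w assume "u \<in> W" "pre n w = u"
    hence "\<bar>bsum f n w - a\<bar> \<le> e" using W(1) by blast
    thus "\<bar>bsum f n w - a'\<bar> \<le> e'" using assms(2) by linarith
  next
    have "2 powr q' \<le> 2 powr q" using assms(3) by simp
    thus "2 powr q' \<le> card W" using W(2) by linarith
  qed (use W(1) in blast)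
qed

lemma rich_append:
  assumes "rich f n a e q" "rich f m b e' r"
  shows "rich f (n + m) (a + b) (e + e') (q + r)"
proof -
  obtain W where W: "\<And>u. u \<in> W \<Longrightarrow> length u = n"
     "\<And>u w. u \<in> W \<Longrightarrow> pre n w = u \<Longrightarrow> \<bar>bsum f n w - a\<bar> \<le> e" "2 powr q \<le> card W"
    using assms(1) unfolding rich_def by blast
  obtain V where V: "\<And>u. u \<in> V \<Longrightarrow> length u = m"
     "\<And>u w. u \<in> V \<Longrightarrow> pre m w = u \<Longrightarrow> \<bar>bsum f m w - b\<bar> \<le> e'" "2 powr r \<le> card V"
    using assms(2) unfolding rich_def by blast
  define X where "X = (\<lambda>(u, v). u @ v) ` (W \<times> V)"
  have "inj_on (\<lambda>(u, v). u @ v) (W \<times> V)"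
    by (rule inj_onI) (use W(1) V(1) in auto)
  hence "card X = card W * card V"
    unfolding X_def by (simp add: card_image card_cartesian_product)
  moreover have "2 powr (q + r) \<le> card W * card V"
    unfolding powr_add of_nat_mult using W(3) V(3) by (intro mult_mono) auto
  moreover have "length x = n + m" if "x \<in> X" for x
    using that W(1) V(1) by (auto simp: X_def)
  moreover have "\<bar>bsum f (n + m) w - (a + b)\<bar> \<le> e + e'" if "pre (n + m) w \<in> X" for w
  proof -
    have "pre n w \<in> W" "pre m ((shift ^^ n) w) \<in> V"
      using that W(1) V(1) unfolding X_def pre_add by auto
    hence "\<bar>bsum f n w - a\<bar> \<le> e" "\<bar>bsum f m ((shift ^^ n) w) - b\<bar> \<le> e'"
      using W(2) V(2) by blast+
    thus ?thesis unfolding bsum_add by linarith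
  qed
  ultimately show ?thesis
    unfolding rich_def by (intro exI[of _ X]) auto
qed

lemma rich_0: "rich f 0 0 0 0"
  unfolding rich_def by (intro exI[of _ "{[]}"]) (simp add: bsum_def)

lemma rich_mult:
  assumes "rich f n a e q"
  shows "rich f (k * n) (k * a) (k * e) (k * q)"
proof (induction k)
  case 0
  show ?case using rich_0 by simp
next
  case (Suc k)
  show ?case using rich_append[OF assms Suc] by (simp add: algebra_simps)
qed

text \<open>The words of length \<open>n\<close> with Birkhoff average close to \<open>\<alpha>\<close> number about \<open>2 powr (n * h)\<close> or
  more, for suitable \<open>n\<close>; since words can be repeated, \<open>n\<close> can be taken arbitrarily large.\<close>

definition rate :: "(binseq \<Rightarrow> real) \<Rightarrow> real \<Rightarrow> real \<Rightarrow> bool" where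
  "rate f \<alpha> h \<longleftrightarrow> (\<forall>\<epsilon>>0. \<exists>n\<ge>1. rich f n (n * \<alpha>) (n * \<epsilon>) (n * (h - \<epsilon>)))"

text \<open>The tolerance in \<open>rate\<close> can be split: half pays for replacing the pair
  (\<alpha>, h) by a nearby pair, half for the words belonging to that pair.\<close>

lemma rate_closed:
  assumes "\<And>\<epsilon>. \<epsilon> > 0 \<Longrightarrow> \<exists>\<beta> s. \<bar>\<beta> - \<alpha>\<bar> \<le> \<epsilon> \<and> h - \<epsilon> \<le> s \<and> rate f \<beta> s"
  shows "rate f \<alpha> h"
  unfolding rate_def
proof (intro allI impI)
  fix \<epsilon> :: real assume \<epsilon>: "\<epsilon> > 0"
  obtain \<beta> s where b: "\<bar>\<beta> - \<alpha>\<bar> \<le> \<epsilon> / 2" "h - \<epsilon> / 2 \<le> s" "rate f \<beta> s"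
    using assms[of "\<epsilon> / 2"] \<epsilon> by auto
  obtain n where n: "n \<ge> 1" "rich f n (n * \<beta>) (n * (\<epsilon> / 2)) (n * (s - \<epsilon> / 2))"
    using b(3) \<epsilon> unfolding rate_def by (meson half_gt_zero)
  have "rich f n (n * \<alpha>) (n * \<epsilon>) (n * (h - \<epsilon>))"
  proof (rule rich_mono[OF n(2)])
    have "\<bar>n * \<beta> - n * \<alpha>\<bar> + n * (\<epsilon> / 2) = n * (\<bar>\<beta> - \<alpha>\<bar> + \<epsilon> / 2)"
      by (simp add: abs_mult distrib_left flip: right_diff_distrib)
    also have "\<dots> \<le> n * \<epsilon>" using b(1) by (intro mult_left_mono) auto
    finally show "\<bar>n * \<beta> - n * \<alpha>\<bar> + n * (\<epsilon> / 2) \<le> n * \<epsilon>" .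
    show "n * (h - \<epsilon>) \<le> n * (s - \<epsilon> / 2)" using b(2) by (intro mult_left_mono) auto
  qed
  thus "\<exists>n\<ge>1. rich f n (n * \<alpha>) (n * \<epsilon>) (n * (h - \<epsilon>))" using n(1) by blast
qed

text \<open>Concatenating words for \<alpha> and words for \<beta> so that they fill the proportions
  t and 1 - t of the length mixes averages and rates in the same proportions.\<close>

lemma rate_concave:
  assumes "rate f \<alpha> h" "rate f \<beta> k" and t: "0 \<le> t" "t \<le> 1"
  shows "rate f (t * \<alpha> + (1 - t) * \<beta>) (t * h + (1 - t) * k)"
  unfolding rate_def
proof (intro allI impI)
  fix \<epsilon> :: real assume \<epsilon>: "\<epsilon> > 0"
  define c where "c = \<bar>\<alpha> - \<beta>\<bar> + \<bar>h - k\<bar> + 1"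
  have c: "c > 0" "\<bar>\<alpha> - \<beta>\<bar> \<le> c" "\<bar>h - k\<bar> \<le> c" by (auto simp: c_def)
  \<comment> \<open>The proportion t is rounded to a fraction r / K. This shifts the averages and
    the rates by at most c / K, so K is taken large enough to make that at most \<epsilon> /
    2.\<close>
  obtain K0 :: nat where K0: "2 * c / \<epsilon> \<le> K0"
    using real_arch_simple by blast
  define K where "K = Suc K0"
  have K: "c / K \<le> \<epsilon> / 2" "K > 0"
  proof -
    have "2 * c \<le> K0 * \<epsilon>" using K0 \<epsilon> by (simp add: field_simps)
    hence "2 * c \<le> K * \<epsilon>" using \<epsilon> by (simp add: K_def algebra_simps)
    thus "c / K \<le> \<epsilon> / 2" by (simp add: K_def field_simps)
  qed (simp add: K_def)
  define r where "r = nat \<lfloor>t * K\<rfloor>"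
  have r: "real r \<le> t * K" "t * K < r + 1"
    using t floor_correct[of "t * K"] by (simp_all add: r_def add.commute)
  have "t * K \<le> K" using t by (simp add: mult_left_le_one_le)
  hence rK: "r \<le> K" using r(1) by linarith
  define s where "s = K - r"
  have s: "real s = real K - real r" using rK by (simp add: s_def)
  have rt: "\<bar>real r - t * K\<bar> \<le> 1" using r by linarith
  obtain n where n: "n \<ge> 1" "rich f n (n * \<alpha>) (n * (\<epsilon> / 2)) (n * (h - \<epsilon> / 2))"
    using assms(1) \<epsilon> unfolding rate_def by (meson half_gt_zero)
  obtain m where m: "m \<ge> 1" "rich f m (m * \<beta>) (m * (\<epsilon> / 2)) (m * (k - \<epsilon> / 2))"
    using assms(2) \<epsilon> unfolding rate_def by (meson half_gt_zero)
  have key: "\<bar>(n * m) * (r * x + s * y) - (n * m * K) * (t * x + (1 - t) * y)\<bar> \<le> (n * m * K) * (\<epsilon> / 2)"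
    if "\<bar>x - y\<bar> \<le> c" for x y :: real
  proof -
    have "(n * m) * (r * x + s * y) - (n * m * K) * (t * x + (1 - t) * y)
         = (n * m) * ((r - t * K) * (x - y))"
      unfolding s by (simp add: algebra_simps)
    also have "\<bar>\<dots>\<bar> = (n * m) * (\<bar>r - t * K\<bar> * \<bar>x - y\<bar>)"
      by (simp add: abs_mult)
    also have "\<dots> \<le> (n * m) * (1 * c)"
      by (intro mult_left_mono mult_mono rt that) auto
    also have "\<dots> = (n * m * K) * (c / K)" using K by simp
    also have "\<dots> \<le> (n * m * K) * (\<epsilon> / 2)"
      by (intro mult_left_mono K) auto
    finally show ?thesis .
  qed
  \<comment> \<open>The two kinds of words have different lengths n and m. Taking
    \<open>m * r\<close> copies of the first and \<open>n * s\<close> of the second gives total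
    lengths in the ratio r : s.\<close>
  have N: "(m * r) * n + (n * s) * m = n * m * K"
    using rK by (simp add: s_def algebra_simps flip: distrib_left)
  have "rich f (n * m * K) (n * m * (r * \<alpha> + s * \<beta>)) (n * m * K * (\<epsilon> / 2))
          (n * m * (r * h + s * k) - n * m * K * (\<epsilon> / 2))"
    using rich_append[OF rich_mult[OF n(2), of "m * r"] rich_mult[OF m(2), of "n * s"]]
    unfolding N
    by (rule rich_mono) (simp_all add: s algebra_simps)
  hence "rich f (n * m * K) ((n * m * K) * (t * \<alpha> + (1 - t) * \<beta>)) ((n * m * K) * \<epsilon>)
           ((n * m * K) * (t * h + (1 - t) * k - \<epsilon>))"
  proof (rule rich_mono)
    show "\<bar>n * m * (r * \<alpha> + s * \<beta>) - (n * m * K) * (t * \<alpha> + (1 - t) * \<beta>)\<bar> + n * m * K * (\<epsilon> / 2)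
        \<le> (n * m * K) * \<epsilon>"
      using key[OF c(2)] by simp
    show "(n * m * K) * (t * h + (1 - t) * k - \<epsilon>) \<le> n * m * (r * h + s * k) - n * m * K * (\<epsilon> / 2)"
      using key[OF c(3)] unfolding right_diff_distrib[of _ _ \<epsilon>] by linarith
  qed
  moreover have "n * m * K \<ge> 1" using n m K by simp
  ultimately show "\<exists>n'\<ge>1. rich f n' (n' * (t * \<alpha> + (1 - t) * \<beta>)) (n' * \<epsilon>)
      (n' * (t * h + (1 - t) * k - \<epsilon>))"
    by blast
qed

text \<open>A single word, a long prefix of w, suffices for rate 0, because the required count
  \<open>2 powr (- n * \<epsilon>)\<close> is at most 1.\<close>

lemma rate_0_if_level:
  assumes f: "continuous_on UNIV f" and w: "(\<lambda>n. bsum f n w / n) \<longlonglongrightarrow> \<alpha>"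
  shows "rate f \<alpha> 0"
  unfolding rate_def
proof (intro allI impI)
  fix \<epsilon> :: real assume \<epsilon>: "\<epsilon> > 0"
  obtain N where N: "\<And>n w v. n \<ge> N \<Longrightarrow> pre n w = pre n v \<Longrightarrow> \<bar>bsum f n w - bsum f n v\<bar> \<le> real n * (\<epsilon> / 2)"
    using bsum_distortion[OF f half_gt_zero[OF \<epsilon>]] by blast
  have "\<forall>\<^sub>F n in sequentially. \<bar>bsum f n w / n - \<alpha>\<bar> < \<epsilon> / 2"
    using tendstoD[OF w, of "\<epsilon> / 2"] \<epsilon> by (simp add: dist_real_def)
  hence "\<forall>\<^sub>F n in sequentially. \<bar>bsum f n w / n - \<alpha>\<bar> < \<epsilon> / 2 \<and> n \<ge> max 1 N"
    by (intro eventually_conj eventually_ge_at_top)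
  then obtain n where n: "\<bar>bsum f n w / n - \<alpha>\<bar> < \<epsilon> / 2" "n \<ge> max 1 N"
    using eventually_happens'[OF sequentially_bot] by blast
  have "bsum f n w - n * \<alpha> = n * (bsum f n w / n - \<alpha>)"
    using n(2) by (simp add: field_simps)
  hence "\<bar>bsum f n w - n * \<alpha>\<bar> = n * \<bar>bsum f n w / n - \<alpha>\<bar>"
    by (simp add: abs_mult)
  also have "\<dots> \<le> n * (\<epsilon> / 2)" using n by (intro mult_left_mono) auto
  finally have A: "\<bar>bsum f n w - n * \<alpha>\<bar> \<le> n * (\<epsilon> / 2)" .
  have "\<bar>bsum f n v - n * \<alpha>\<bar> \<le> n * \<epsilon>" if "pre n v = pre n w" for v
  proof -
    have "\<bar>bsum f n v - n * \<alpha>\<bar> \<le> \<bar>bsum f n w - n * \<alpha>\<bar> + \<bar>bsum f n v - bsum f n w\<bar>"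
      by linarith
    also have "\<dots> \<le> n * (\<epsilon> / 2) + n * (\<epsilon> / 2)"
      using A N that n(2) by (intro add_mono) auto
    finally show ?thesis by (simp add: algebra_simps)
  qed
  hence "rich f n (n * \<alpha>) (n * \<epsilon>) (n * (0 - \<epsilon>))"
    unfolding rich_def using \<epsilon> powr_mono[of "- (real n * \<epsilon>)" 0 2] by (intro exI[of _ "{pre n w}"]) auto
  thus "\<exists>n\<ge>1. rich f n (n * \<alpha>) (n * \<epsilon>) (n * (0 - \<epsilon>))" using n(2) by auto
qed

lemma rate_uminus: "rate f \<alpha> h \<Longrightarrow> rate (\<lambda>w. - f w) (- \<alpha>) h"
proof -
  have [simp]: "bsum (\<lambda>w. - f w) n w = - bsum f n w" for n w
    by (simp add: bsum_def sum_negf)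
  have "\<bar>- bsum f n w - real n * - \<alpha>\<bar> = \<bar>bsum f n w - real n * \<alpha>\<bar>" for n w
    by (simp add: abs_minus_commute)
  thus "rate f \<alpha> h \<Longrightarrow> rate (\<lambda>w. - f w) (- \<alpha>) h"
    unfolding rate_def rich_def by simp
qed

section \<open>Hausdorff dimension of sets of sequences\<close>

lemma diameter_cylinder_le: "diameter {w. pre n w = u} \<le> 1 / 2 ^ n"
proof -
  have "dist v w \<le> 1 / 2 ^ n" if "pre n v = u" "pre n w = u" for v w
    by (rule dist_binseq_le) (use that in \<open>metis pre_eq_iff\<close>)
  thus ?thesis unfolding diameter_def by (auto intro!: cSUP_least)
qed

lemma bounded_binseq: "bounded (A :: binseq set)"
  using bounded_subset[OF compact_imp_bounded[OF compact_binseq]] by blast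

text \<open>Every point of A lies in all late \<open>G n\<close>, so one may wait for a scale with a
  good count. For each N such a scale beyond N is chosen; its cylinders cover the points that have
  settled by time N and cost at most \<open>\<epsilon> / 2 ^ Suc N\<close>.\<close>

lemma hausdorff_dim_le_cylinders:
  fixes A :: "binseq set"
  assumes s: "0 < s" "s' < s"
  assumes cover: "A \<subseteq> {w. \<exists>N. \<forall>n\<ge>N. w \<in> G n}"
  assumes count: "\<And>N. \<exists>n\<ge>N. card (pre n ` G n) \<le> K * 2 powr (n * s')"
  shows "hausdorff_dim A \<le> ennreal s"
proof -
  have small: "hausdorff_premeasure s \<delta> A \<le> ennreal \<epsilon>" if "\<delta> > 0" "\<epsilon> > 0" for \<delta> \<epsilon>
  proof -
    have lim: "(\<lambda>n. K * (2 powr (s' - s)) ^ n) \<longlonglongrightarrow> K * 0"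
      by (intro tendsto_mult tendsto_const LIMSEQ_realpow_zero)
         (use s powr_less_mono[of "s' - s" 0 2] in auto)
    have "\<exists>n\<ge>N. 1 / 2 ^ n \<le> \<delta> \<and> card (pre n ` G n) * (1 / 2 ^ n) powr s \<le> \<epsilon> / 2 ^ Suc N" for N
    proof -
      have "\<forall>\<^sub>F n in sequentially. K * (2 powr (s' - s)) ^ n < \<epsilon> / 2 ^ Suc N"
        by (rule order_tendstoD(2)[OF lim]) (use \<open>\<epsilon> > 0\<close> in simp)
      moreover have "(\<lambda>n. (1/2) ^ n) \<longlonglongrightarrow> (0::real)"
        by (rule LIMSEQ_realpow_zero) auto
      hence "\<forall>\<^sub>F n in sequentially. (1/2) ^ n < \<delta>"
        by (rule order_tendstoD(2)) fact
      ultimately have "\<forall>\<^sub>F n in sequentially. K * (2 powr (s' - s)) ^ n < \<epsilon> / 2 ^ Suc N \<and> (1/2) ^ n < \<delta>"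
        by (rule eventually_conj)
      then obtain M where M: "\<And>n. n \<ge> M \<Longrightarrow> K * (2 powr (s' - s)) ^ n < \<epsilon> / 2 ^ Suc N \<and> (1/2) ^ n < \<delta>"
        unfolding eventually_sequentially by blast
      obtain n where n: "n \<ge> max M N" "card (pre n ` G n) \<le> K * 2 powr (n * s')"
        using count by blast
      have "(1 / 2 ^ n) powr s = 2 powr (- real n * s)"
        by (simp add: powr_minus_divide powr_divide powr_powr flip: powr_realpow)
      hence "card (pre n ` G n) * (1 / 2 ^ n) powr s \<le> (K * 2 powr (n * s')) * 2 powr (- real n * s)"
        using n(2) by (simp add: mult_right_mono)
      also have "\<dots> = K * (2 powr (s' - s)) ^ n"
        by (simp add: powr_power algebra_simps flip: powr_add)
      finally show ?thesis
        using M[of n] n(1) by (intro exI[of _ n]) (auto simp: power_one_over)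
    qed
    then obtain n where n: "\<And>N. n N \<ge> N" "\<And>N. 1 / 2 ^ n N \<le> \<delta>"
       "\<And>N. card (pre (n N) ` G (n N)) * (1 / 2 ^ n N) powr s \<le> \<epsilon> / 2 ^ Suc N"
      by metis
    define P where "P = (\<lambda>N. pre (n N) ` G (n N))"
    have "\<exists>e. bij_betw e {0..<card (P N)} (P N)" for N
      unfolding P_def by (rule ex_bij_betw_nat_finite[OF finite_range_pre])
    then obtain e where e: "\<And>N. bij_betw (e N) {0..<card (P N)} (P N)" by metis
    \<comment> \<open>The finite covers for all N are merged into one sequence through pairs (N, j);
      indices j beyond the number of cylinders give the empty set, of diameter 0.\<close>
    define F where "F = (\<lambda>(N, j). if j < card (P N) then {w. pre (n N) w = e N j} else {})"
    have diam: "diameter (F (N, j)) \<le> 1 / 2 ^ n N" for N j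
      using diameter_cylinder_le by (auto simp: F_def)
    have A: "A \<subseteq> (\<Union>i. F (prod_decode i))"
    proof
      fix w assume "w \<in> A"
      then obtain N where "w \<in> G (n N)" using cover n(1) by blast
      hence "pre (n N) w \<in> P N" by (simp add: P_def)
      then obtain j where "j < card (P N)" "e N j = pre (n N) w"
        using e[of N] unfolding bij_betw_def by (metis atLeastLessThan_iff imageE)
      hence "w \<in> F (prod_decode (prod_encode (N, j)))" by (simp add: F_def)
      thus "w \<in> (\<Union>i. F (prod_decode i))" by blast
    qed
    have "diameter (F (prod_decode i)) \<le> \<delta>" for i
      using diam n(2) by (metis order_trans surj_pair)
    hence "hausdorff_premeasure s \<delta> A \<le> (\<Sum>i. ennreal (diameter (F (prod_decode i)) powr s))"
      unfolding hausdorff_premeasure_def using A bounded_binseq by (intro INF_lower) auto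
    also have "\<dots> = (\<Sum>N. \<Sum>j. ennreal (diameter (F (N, j)) powr s))"
      using suminf_ennreal_2dimen[of _ "\<lambda>x. ennreal (diameter (F x) powr s)", OF refl]
      by (simp add: o_def)
    also have "\<dots> \<le> (\<Sum>N. ennreal (\<epsilon> * (1/2) ^ Suc N))"
    proof (rule suminf_le)
      fix N
      have "(\<Sum>j. ennreal (diameter (F (N, j)) powr s)) = (\<Sum>j<card (P N). ennreal (diameter (F (N, j)) powr s))"
        by (rule suminf_finite) (auto simp: F_def)
      also have "\<dots> \<le> (\<Sum>j<card (P N). ennreal ((1 / 2 ^ n N) powr s))"
        using s diam diameter_ge_0[OF bounded_binseq] by (intro sum_mono ennreal_leI powr_mono2) auto
      also have "\<dots> = ennreal (card (P N) * (1 / 2 ^ n N) powr s)"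
        by (simp add: ennreal_mult ennreal_of_nat_eq_real_of_nat)
      also have "\<dots> \<le> ennreal (\<epsilon> * (1/2) ^ Suc N)"
        using n(3)[of N] by (intro ennreal_leI) (simp add: P_def power_one_over)
      finally show "(\<Sum>j. ennreal (diameter (F (N, j)) powr s)) \<le> ennreal (\<epsilon> * (1/2) ^ Suc N)" .
    qed auto
    also have "\<dots> = ennreal \<epsilon>"
    proof (rule suminf_ennreal_eq)
      show "(\<lambda>N. \<epsilon> * (1/2) ^ Suc N) sums \<epsilon>"
        using sums_mult[OF power_half_series, of \<epsilon>] by simp
    qed (use \<open>\<epsilon> > 0\<close> in auto)
    finally show ?thesis .
  qed
  have "hausdorff_premeasure s \<delta> A \<le> 0" if "\<delta> > 0" for \<delta>
    by (rule ennreal_le_epsilon) (simp add: small that)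
  hence "hausdorff_measure s A = 0"
    unfolding hausdorff_measure_def by (simp add: SUP_eq_iff bot_ennreal)
  thus ?thesis
    unfolding hausdorff_dim_def using s by (intro INF_lower) auto
qed

text \<open>The distance to the zero sequence is the number whose binary digits are those of the
  sequence, so the usual expansion of y provides the point.\<close>

lemma binary_expansion:
  assumes "0 \<le> y" "y < 1"
  shows "\<exists>v. dist v (Binseq (\<lambda>_. False)) = y"
proof -
  define v where "v = Binseq (\<lambda>k. odd \<lfloor>y * 2 ^ Suc k\<rfloor>)"
  have *: "\<lfloor>x * 2\<rfloor> = 2 * \<lfloor>x\<rfloor> + of_bool (odd \<lfloor>x * 2\<rfloor>)" for x :: real
  proof -
    have "\<lfloor>x * 2\<rfloor> = 2 * \<lfloor>x\<rfloor> \<or> \<lfloor>x * 2\<rfloor> = 2 * \<lfloor>x\<rfloor> + 1"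
      by linarith
    thus ?thesis by auto
  qed
  \<comment> \<open>Truncating the expansion after n digits rounds y down to a multiple of
    \<open>1 / 2 ^ n\<close>.\<close>
  have part: "(\<Sum>k<n. of_bool (digit v k) / 2 ^ Suc k) = \<lfloor>y * 2 ^ n\<rfloor> / (2 ^ n :: real)" for n
  proof (induction n)
    case 0
    show ?case using assms by (simp add: floor_eq_iff)
  next
    case (Suc n)
    have "\<lfloor>y * 2 ^ Suc n\<rfloor> = 2 * \<lfloor>y * 2 ^ n\<rfloor> + of_bool (digit v n)"
      using *[of "y * 2 ^ n"] by (simp add: v_def mult_ac)
    hence "real_of_int \<lfloor>y * 2 ^ Suc n\<rfloor> = 2 * \<lfloor>y * 2 ^ n\<rfloor> + of_bool (digit v n)"
      by (simp add: of_bool_def)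
    thus ?case unfolding sum.lessThan_Suc Suc by (simp add: add_divide_distrib)
  qed
  have "(\<lambda>n. \<lfloor>y * 2 ^ n\<rfloor> / (2 ^ n :: real) - y) \<longlonglongrightarrow> 0"
  proof (rule Lim_null_comparison)
    show "(\<lambda>n. (1/2) ^ n) \<longlonglongrightarrow> (0::real)"
      by (rule LIMSEQ_realpow_zero) auto
    have "\<bar>\<lfloor>y * 2 ^ n\<rfloor> - y * 2 ^ n\<bar> \<le> 1" for n by linarith
    hence "\<bar>\<lfloor>y * 2 ^ n\<rfloor> - y * 2 ^ n\<bar> / 2 ^ n \<le> 1 / 2 ^ n" for n
      by (rule divide_right_mono) simp
    moreover have "\<lfloor>y * 2 ^ n\<rfloor> / (2 ^ n :: real) - y = (\<lfloor>y * 2 ^ n\<rfloor> - y * 2 ^ n) / 2 ^ n" for n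
      by (simp add: diff_divide_distrib)
    ultimately show "\<forall>\<^sub>F n in sequentially. norm (\<lfloor>y * 2 ^ n\<rfloor> / (2 ^ n :: real) - y) \<le> (1/2) ^ n"
      by (simp add: power_one_over)
  qed
  hence "(\<lambda>k. of_bool (digit v k) / 2 ^ Suc k) sums y"
    unfolding sums_def part by (simp add: LIM_zero_iff)
  thus ?thesis
    by (intro exI[of _ v]) (simp add: dist_binseq_def sums_iff)
qed

text \<open>Pulling a cover back along \<open>\<Psi>\<close> and applying the \<open>1\<close>-Lipschitz map \<open>v \<mapsto> dist v 0\<close>, which
  is the binary expansion, produces a cover of the unit interval.\<close>

lemma hausdorff_dim_ge_holder:
  fixes A :: "binseq set" and \<Psi> :: "binseq \<Rightarrow> binseq"
  assumes "0 < s" "0 < C"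
    and holder: "\<And>v w. dist v w \<le> C * dist (\<Psi> v) (\<Psi> w) powr s"
    and range: "range \<Psi> \<subseteq> A"
  shows "ennreal s \<le> hausdorff_dim A"
  unfolding hausdorff_dim_def
proof (rule INF_greatest, clarify, rule ccontr)
  fix t assume t: "0 < t" "hausdorff_measure t A = 0" "\<not> ennreal s \<le> ennreal t"
  have ts: "t \<le> s" using t(3) by (meson ennreal_leI linear)
  define b where "b = (\<lambda>v. dist v (Binseq (\<lambda>_. False)))"
  have b: "\<bar>b v - b w\<bar> \<le> dist v w" for v w
    using dist_triangle[of v "Binseq (\<lambda>_. False)" w] dist_triangle[of w "Binseq (\<lambda>_. False)" v]
    unfolding b_def by (simp add: dist_commute abs_le_iff)
  have "ennreal (1 / (2 * C)) \<le> hausdorff_premeasure t 1 A"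
    unfolding hausdorff_premeasure_def
  proof (rule INF_greatest, clarify)
    fix U :: "nat \<Rightarrow> binseq set"
    assume U: "A \<subseteq> (\<Union>i. U i)" "\<forall>i. bounded (U i) \<and> diameter (U i) \<le> 1"
    define c where "c = (\<lambda>i. SOME v. \<Psi> v \<in> U i)"
    define r where "r = (\<lambda>i. C * diameter (U i) powr s)"
    have r: "0 \<le> r i" for i using \<open>0 < C\<close> by (simp add: r_def)
    have "{0..<1} \<subseteq> (\<Union>i. {b (c i) - r i..b (c i) + r i})"
    proof
      fix y :: real assume "y \<in> {0..<1}"
      then obtain v where v: "b v = y"
        using binary_expansion[of y] by (auto simp: b_def)
      obtain i where i: "\<Psi> v \<in> U i" using U(1) range by blast
      hence ci: "\<Psi> (c i) \<in> U i" unfolding c_def by (rule someI)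
      have "\<bar>b v - b (c i)\<bar> \<le> dist v (c i)" by (rule b)
      also have "\<dots> \<le> C * dist (\<Psi> v) (\<Psi> (c i)) powr s" by (rule holder)
      also have "\<dots> \<le> r i"
        unfolding r_def using i ci U(2) \<open>0 < s\<close> \<open>0 < C\<close>
        by (intro mult_left_mono powr_mono2 diameter_bounded_bound) auto
      finally show "y \<in> (\<Union>i. {b (c i) - r i..b (c i) + r i})"
        using v by (auto simp: abs_le_iff intro!: exI[of _ i])
    qed
    hence "emeasure lborel {0..<1::real} \<le> emeasure lborel (\<Union>i. {b (c i) - r i..b (c i) + r i})"
      by (intro emeasure_mono) auto
    also have "\<dots> \<le> (\<Sum>i. emeasure lborel {b (c i) - r i..b (c i) + r i})"
      by (rule emeasure_subadditive_countably) auto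
    also have "\<dots> = (\<Sum>i. ennreal (2 * C) * ennreal (diameter (U i) powr s))"
      using r \<open>0 < C\<close> by (intro suminf_cong) (simp add: r_def mult_ac flip: ennreal_mult)
    also have "\<dots> = ennreal (2 * C) * (\<Sum>i. ennreal (diameter (U i) powr s))"
      by (rule ennreal_suminf_cmult)
    \<comment> \<open>Diameters are at most 1, so lowering the exponent from s to t can only
      increase the sum.\<close>
    also have "\<dots> \<le> ennreal (2 * C) * (\<Sum>i. ennreal (diameter (U i) powr t))"
      using U(2) ts by (intro mult_left_mono suminf_le ennreal_leI powr_mono')
         (auto simp: diameter_ge_0)
    finally have "ennreal (1 / (2 * C)) * 1
        \<le> ennreal (1 / (2 * C)) * (ennreal (2 * C) * (\<Sum>i. ennreal (diameter (U i) powr t)))"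
      by (intro mult_left_mono) auto
    also have "\<dots> = (\<Sum>i. ennreal (diameter (U i) powr t))"
      using \<open>0 < C\<close> by (simp add: mult.assoc[symmetric] flip: ennreal_mult)
    finally show "ennreal (1 / (2 * C)) \<le> (\<Sum>i. ennreal (diameter (U i) powr t))" by simp
  qed
  also have "\<dots> \<le> hausdorff_measure t A"
    unfolding hausdorff_measure_def by (rule SUP_upper) simp
  finally show False using t(2) \<open>0 < C\<close> by (simp add: ennreal_eq_0_iff)
qed

text \<open>If the rate s failed for some \<epsilon>, then for every n there would be fewer than
  \<open>2 powr (n * (s - \<epsilon>))\<close> good words, and the cylinder cover would force
  dimension at most s.\<close>

lemma rate_if_dim_level_gt:
  assumes f: "continuous_on UNIV f" and s: "0 < s"
    and dim: "ennreal s < hausdorff_dim {w. (\<lambda>n. bsum f n w / n) \<longlonglongrightarrow> \<alpha>}"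
  shows "rate f \<alpha> s"
proof (rule ccontr)
  assume "\<not> rate f \<alpha> s"
  then obtain \<epsilon> where \<epsilon>: "\<epsilon> > 0" "\<And>n. n \<ge> 1 \<Longrightarrow> \<not> rich f n (n * \<alpha>) (n * \<epsilon>) (n * (s - \<epsilon>))"
    unfolding rate_def by blast
  obtain N where N: "\<And>n w v. n \<ge> N \<Longrightarrow> pre n w = pre n v \<Longrightarrow> \<bar>bsum f n w - bsum f n v\<bar> \<le> n * (\<epsilon> / 2)"
    using bsum_distortion[OF f half_gt_zero[OF \<epsilon>(1)]] by blast
  \<comment> \<open>Only \<epsilon> / 2 is allowed here; distortion uses the other half when the
    bound is extended to all sequences with the same prefix.\<close>
  define G where "G = (\<lambda>n. {w. \<bar>bsum f n w - n * \<alpha>\<bar> \<le> n * (\<epsilon> / 2)})"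
  have "hausdorff_dim {w. (\<lambda>n. bsum f n w / n) \<longlonglongrightarrow> \<alpha>} \<le> ennreal s"
  proof (rule hausdorff_dim_le_cylinders)
    show "s - \<epsilon> < s" using \<epsilon> by simp
    show "{w. (\<lambda>n. bsum f n w / n) \<longlonglongrightarrow> \<alpha>} \<subseteq> {w. \<exists>N. \<forall>n\<ge>N. w \<in> G n}"
    proof clarify
      fix w assume w: "(\<lambda>n. bsum f n w / n) \<longlonglongrightarrow> \<alpha>"
      have "\<forall>\<^sub>F n in sequentially. \<bar>bsum f n w / n - \<alpha>\<bar> < \<epsilon> / 2 \<and> n \<ge> 1"
        using tendstoD[OF w, of "\<epsilon> / 2"] \<epsilon>
        by (intro eventually_conj eventually_ge_at_top) (simp add: dist_real_def)
      then obtain N where N: "\<And>n. n \<ge> N \<Longrightarrow> \<bar>bsum f n w / n - \<alpha>\<bar> < \<epsilon> / 2 \<and> n \<ge> 1"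
        unfolding eventually_sequentially by blast
      show "\<exists>N. \<forall>n\<ge>N. w \<in> G n"
      proof (intro exI[of _ N] allI impI)
        fix n assume "n \<ge> N"
        hence *: "\<bar>bsum f n w / n - \<alpha>\<bar> < \<epsilon> / 2" "n \<ge> 1" using N by blast+
        have "bsum f n w - n * \<alpha> = n * (bsum f n w / n - \<alpha>)"
          using *(2) by (simp add: field_simps)
        hence "\<bar>bsum f n w - n * \<alpha>\<bar> = n * \<bar>bsum f n w / n - \<alpha>\<bar>"
          by (simp add: abs_mult)
        also have "\<dots> \<le> n * (\<epsilon> / 2)" using * by (intro mult_left_mono) auto
        finally show "w \<in> G n" by (simp add: G_def)
      qed
    qed
    show "\<exists>n\<ge>M. card (pre n ` G n) \<le> 1 * 2 powr (n * (s - \<epsilon>))" for M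
    proof -
      define n where "n = max 1 (max M N)"
      have n: "n \<ge> 1" "n \<ge> M" "n \<ge> N" by (auto simp: n_def)
      have "\<bar>bsum f n w - n * \<alpha>\<bar> \<le> n * \<epsilon>" if "v \<in> G n" "pre n w = pre n v" for v w
      proof -
        have "\<bar>bsum f n w - n * \<alpha>\<bar> \<le> \<bar>bsum f n v - n * \<alpha>\<bar> + \<bar>bsum f n w - bsum f n v\<bar>"
          by linarith
        also have "\<dots> \<le> n * (\<epsilon> / 2) + n * (\<epsilon> / 2)"
          using N[OF n(3) that(2)] that(1) by (intro add_mono) (auto simp: G_def)
        finally show ?thesis by (simp add: algebra_simps)
      qed
      hence "\<not> 2 powr (n * (s - \<epsilon>)) \<le> card (pre n ` G n)"
        using \<epsilon>(2)[OF n(1)] unfolding rich_def by (metis (no_types, lifting) imageE length_pre)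
      thus ?thesis using n(2) by (intro exI[of _ n]) simp
    qed
  qed (rule s)
  with dim show False by simp
qed

section \<open>Level sets contain large concatenation sets\<close>

lemma ex_interval_index:
  fixes F :: "nat \<Rightarrow> nat"
  assumes "F 0 = 0" "\<exists>i. r < F (Suc i)"
  shows "\<exists>i. F i \<le> r \<and> r < F (Suc i)"
proof -
  define i where "i = (LEAST i. r < F (Suc i))"
  have "r < F (Suc i)" unfolding i_def by (rule LeastI_ex) fact
  moreover have "F i \<le> r"
  proof (cases i)
    case (Suc j)
    hence "\<not> r < F (Suc j)" using not_less_Least[of j "\<lambda>i. r < F (Suc i)"] by (simp add: i_def)
    thus ?thesis using Suc by simp
  qed (simp add: assms)
  ultimately show ?thesis by blast
qed

lemma ex_infinite_concatenation:
  fixes l :: "nat \<Rightarrow> nat"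
  assumes len: "\<And>i. length (u i) = l i" and l: "\<And>i. l i \<ge> 1"
  shows "\<exists>x. \<forall>i. pre (l i) ((shift ^^ (\<Sum>j<i. l j)) x) = u i"
proof -
  define N where "N = (\<lambda>i. \<Sum>j<i. l j)"
  \<comment> \<open>The index of the block that contains position k.\<close>
  define b where "b = (\<lambda>k. LEAST i. k < N (Suc i))"
  define x where "x = Binseq (\<lambda>k. u (b k) ! (k - N (b k)))"
  have mono: "N i \<le> N j" if "i \<le> j" for i j
    unfolding N_def by (rule sum_mono2) (use that in auto)
  have b: "b (N i + m) = i" if "m < l i" for i m
    unfolding b_def
  proof (rule Least_equality)
    show "N i + m < N (Suc i)" using that by (simp add: N_def)
    fix j assume "N i + m < N (Suc j)"
    thus "i \<le> j" using mono[of "Suc j" i] by (metis leI le_add1 le_trans not_le not_less_eq_eq)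
  qed
  have "pre (l i) ((shift ^^ N i) x) = u i" for i
    by (rule nth_equalityI) (simp_all add: len x_def b)
  thus ?thesis unfolding N_def by blast
qed

text \<open>Better approximations may need much longer words. Delaying the passage to the next
  quality keeps the length \<open>n (g i)\<close> of block i negligible against i, hence against the
  total length of the earlier blocks.\<close>

lemma ex_slow_sequence:
  fixes n :: "nat \<Rightarrow> nat"
  shows "\<exists>g. (\<forall>i. n (g i) * g i \<le> i) \<and> filterlim g at_top sequentially"
proof -
  define S where "S = (\<lambda>i. {j. j \<le> i \<and> n j * j \<le> i})"
  define g where "g = (\<lambda>i. Max (S i))"
  have S: "finite (S i)" "S i \<noteq> {}" for i
  proof -
    have "S i \<subseteq> {..i}" by (auto simp: S_def)
    thus "finite (S i)" by (rule finite_subset) simp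
    have "0 \<in> S i" by (simp add: S_def)
    thus "S i \<noteq> {}" by blast
  qed
  have "g i \<in> S i" for i unfolding g_def using S by (rule Max_in)
  hence "\<forall>i. n (g i) * g i \<le> i" by (simp add: S_def)
  moreover have "filterlim g at_top sequentially"
    unfolding filterlim_at_top eventually_sequentially
  proof (intro allI exI impI)
    fix j i assume "max j (n j * j) \<le> i"
    hence "j \<in> S i" by (simp add: S_def)
    thus "j \<le> g i" unfolding g_def by (rule Max_ge[OF S(1)])
  qed
  ultimately show ?thesis by blast
qed

text \<open>The count of good words is recast as an injective code from free words of q bits to good
  words of length n, so that arbitrary sequences can be encoded block by block.\<close>

definition coding ::
    "(binseq \<Rightarrow> real) \<Rightarrow> real \<Rightarrow> real \<Rightarrow> real \<Rightarrow> nat \<Rightarrow> nat \<Rightarrow> (bool list \<Rightarrow> bool list) \<Rightarrow> bool" where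
  "coding f \<alpha> h \<epsilon> n q e \<longleftrightarrow>
     n \<ge> 1 \<and> inj_on e {u. length u = q} \<and> n * (h - \<epsilon>) \<le> real q \<and>
     (\<forall>u. length u = q \<longrightarrow> length (e u) = n \<and>
        (\<forall>w. pre n w = e u \<longrightarrow> \<bar>bsum f n w - n * \<alpha>\<bar> \<le> n * \<epsilon>))"

lemma rate_coding:
  assumes "rate f \<alpha> h" "\<epsilon> > 0"
  shows "\<exists>n q e. coding f \<alpha> h \<epsilon> n q e"
proof -
  obtain m where m: "m \<ge> 1" "rich f m (m * \<alpha>) (m * (\<epsilon> / 2)) (m * (h - \<epsilon> / 2))"
    using assms unfolding rate_def by (meson half_gt_zero)
  \<comment> \<open>With k repetitions, \<open>n * (\<epsilon> / 2)\<close> is at least 1, which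
    pays for rounding the number of bits down to an integer q.\<close>
  obtain k :: nat where k: "2 / \<epsilon> \<le> k" using real_arch_simple by blast
  have "k > 0" using k \<open>\<epsilon> > 0\<close> by (cases "k = 0") (auto simp: field_simps)
  define n where "n = k * m"
  have "k \<le> n" using m(1) by (simp add: n_def)
  have "2 \<le> k * \<epsilon>" using k \<open>\<epsilon> > 0\<close> by (simp add: field_simps)
  also have "k * \<epsilon> \<le> n * \<epsilon>" using \<open>k \<le> n\<close> \<open>\<epsilon> > 0\<close> by (intro mult_right_mono) auto
  finally have n: "n \<ge> 1" "1 \<le> n * (\<epsilon> / 2)" using \<open>k > 0\<close> m(1) by (simp_all add: n_def)
  have "rich f n (n * \<alpha>) (n * (\<epsilon> / 2)) (n * (h - \<epsilon> / 2))"
    using rich_mult[OF m(2), of k] by (simp add: n_def mult.assoc)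
  then obtain W where W: "\<And>u. u \<in> W \<Longrightarrow> length u = n"
      "\<And>u w. u \<in> W \<Longrightarrow> pre n w = u \<Longrightarrow> \<bar>bsum f n w - n * \<alpha>\<bar> \<le> n * (\<epsilon> / 2)"
      "2 powr (n * (h - \<epsilon> / 2)) \<le> card W"
    unfolding rich_def by blast
  define q where "q = nat \<lfloor>n * (h - \<epsilon> / 2)\<rfloor>"
  have W0: "card W > 0" using W(3) by (metis not_gr_zero not_le of_nat_0 powr_gt_zero zero_neq_numeral)
  have "real (2 ^ q) \<le> card W"
  \<comment> \<open>For a negative exponent \<open>nat\<close> yields q = 0, and a code for the
    empty word only needs W to be nonempty.\<close>
  proof (cases "n * (h - \<epsilon> / 2) \<ge> 0")
    case True
    hence "real q \<le> n * (h - \<epsilon> / 2)" by (simp add: q_def)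
    hence "2 powr real q \<le> 2 powr (n * (h - \<epsilon> / 2))" by simp
    moreover have "real (2 ^ q) = 2 powr real q" by (simp add: powr_realpow)
    ultimately show ?thesis using W(3) by linarith
  next
    case False
    hence "q = 0" by (simp add: q_def)
    thus ?thesis using W0 by simp
  qed
  hence "card {u :: bool list. length u = q} \<le> card W"
    using card_lists_length_eq[of "UNIV :: bool set" q] by simp
  moreover have "finite W" using W0 by (simp add: card_gt_0_iff)
  moreover have "finite {u :: bool list. length u = q}"
    using finite_lists_length_eq[of "UNIV :: bool set" q] by simp
  ultimately obtain e where e: "e ` {u :: bool list. length u = q} \<subseteq> W" "inj_on e {u. length u = q}"
    using card_le_inj by metis
  have "n * (h - \<epsilon>) \<le> n * (h - \<epsilon> / 2) - 1" using n(2) by (simp add: right_diff_distrib)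
  also have "\<dots> \<le> q" by (simp add: q_def) linarith
  finally have "n * (h - \<epsilon>) \<le> q" .
  moreover have "length (e u) = n \<and> (\<forall>w. pre n w = e u \<longrightarrow> \<bar>bsum f n w - n * \<alpha>\<bar> \<le> n * \<epsilon>)"
    if "length u = q" for u
  proof (intro conjI allI impI)
    have eu: "e u \<in> W" using e(1) that by blast
    thus "length (e u) = n" by (rule W(1))
    fix w assume "pre n w = e u"
    with eu have "\<bar>bsum f n w - n * \<alpha>\<bar> \<le> n * (\<epsilon> / 2)" by (rule W(2))
    also have "\<dots> \<le> n * \<epsilon>" using \<open>\<epsilon> > 0\<close> by simp
    finally show "\<bar>bsum f n w - n * \<alpha>\<bar> \<le> n * \<epsilon>" .
  qed
  ultimately show ?thesis unfolding coding_def using n(1) e(2) by blast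
qed

text \<open>A free sequence v is cut into blocks of \<open>p i\<close> bits, and each is replaced by
  its code word of length \<open>l i\<close>. The resulting map \<open>\<Psi>\<close> lands in the
  level set because the tolerances tend to 0, and its inverse is Hoelder of exponent s because the
  ratio of source to image length eventually exceeds s.\<close>

lemma dim_level_ge_if_rate:
  assumes f: "continuous_on UNIV f" and rate: "rate f \<alpha> h" and s: "0 < s" "s < h"
  shows "ennreal s \<le> hausdorff_dim {w. (\<lambda>n. bsum f n w / n) \<longlonglongrightarrow> \<alpha>}"
proof -
  obtain B where B: "B > 0" "\<And>w. \<bar>f w\<bar> \<le> B" using bounded_on_binseq[OF f] by blast
  define \<epsilon> where "\<epsilon> = (\<lambda>j::nat. 1 / real (Suc j))"
  have \<epsilon>: "\<epsilon> j > 0" for j by (simp add: \<epsilon>_def)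
  have "\<forall>j. \<exists>n q e. coding f \<alpha> h (\<epsilon> j) n q e"
    by (intro allI rate_coding[OF rate \<epsilon>])
  then obtain n where "\<forall>j. \<exists>q e. coding f \<alpha> h (\<epsilon> j) (n j) q e"
    by (rule choice[THEN exE])
  then obtain q where "\<forall>j. \<exists>e. coding f \<alpha> h (\<epsilon> j) (n j) (q j) e"
    by (rule choice[THEN exE])
  then obtain e where "\<forall>j. coding f \<alpha> h (\<epsilon> j) (n j) (q j) (e j)"
    by (rule choice[THEN exE])
  note code = this[rule_format, unfolded coding_def, THEN conjunct1]
    this[rule_format, unfolded coding_def, THEN conjunct2, THEN conjunct1]
    this[rule_format, unfolded coding_def, THEN conjunct2, THEN conjunct2, THEN conjunct1]
    this[rule_format, unfolded coding_def, THEN conjunct2, THEN conjunct2, THEN conjunct2,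
      rule_format, THEN conjunct1]
    this[rule_format, unfolded coding_def, THEN conjunct2, THEN conjunct2, THEN conjunct2,
      rule_format, THEN conjunct2, rule_format]
  obtain g where g: "\<And>i. n (g i) * g i \<le> i" "filterlim g at_top sequentially"
    using ex_slow_sequence by blast
  define l p where "l = (\<lambda>i. n (g i))" and "p = (\<lambda>i. q (g i))"
  define N Q where "N = (\<lambda>i. \<Sum>j<i. l j)" and "Q = (\<lambda>i. \<Sum>j<i. p j)"
  define \<eta> where "\<eta> = (\<lambda>i. \<epsilon> (g i))"
  define R where "R = (\<lambda>i. \<Sum>j<i. l j * \<eta> j)"
  have \<eta>0: "\<eta> i > 0" for i by (simp add: \<eta>_def \<epsilon>)
  have l: "l i \<ge> 1" for i unfolding l_def by (rule code(1))
  have N_Suc: "N (Suc i) = N i + l i" and N_0: "N 0 = 0" for i by (simp_all add: N_def)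
  have N_mono: "N i \<le> N j" if "i \<le> j" for i j
    unfolding N_def by (rule sum_mono2) (use that in auto)
  have N_ge: "i \<le> N i" for i
  proof (induction i)
    case (Suc i)
    thus ?case using l[of i] by (simp add: N_Suc)
  qed simp
  have \<eta>_lim: "\<eta> \<longlonglongrightarrow> 0"
    unfolding \<eta>_def using filterlim_compose[OF LIMSEQ_Suc[OF lim_1_over_n] g(2)] by (simp add: \<epsilon>_def)
  \<comment> \<open>The accumulated tolerance \<open>R i\<close> and the length of the next block
    are both negligible against \<open>N i\<close>. This serves twice: for convergence of the
    averages and for the Hoelder estimate.\<close>
  have error: "\<exists>I. \<forall>i\<ge>I. R i + l i * D \<le> \<delta> * N i" if "\<delta> > 0" "D > 0" for \<delta> D :: real
  proof -
    \<comment> \<open>One third of \<delta> each for the blocks before J, for the later blocks with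
      tolerance at most \<delta> / 3, and for the next block.\<close>
    obtain J where J: "\<And>j. j \<ge> J \<Longrightarrow> \<eta> j \<le> \<delta> / 3"
      using order_tendstoD(2)[OF \<eta>_lim, of "\<delta> / 3"] \<open>\<delta> > 0\<close>
      unfolding eventually_sequentially by (auto intro: less_imp_le)
    obtain m :: nat where m: "D / (\<delta> / 3) \<le> m" using real_arch_simple by blast
    have "\<forall>\<^sub>F i in sequentially. m \<le> g i" using g(2) unfolding filterlim_at_top by blast
    then obtain M where M: "\<And>i. i \<ge> M \<Longrightarrow> m \<le> g i" unfolding eventually_sequentially by blast
    obtain k :: nat where k: "R J / (\<delta> / 3) \<le> k" using real_arch_simple by blast
    have "R i + l i * D \<le> \<delta> * N i" if i: "i \<ge> max J (max M k)" for i
    proof -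
      have "D \<le> (\<delta> / 3) * m" using m \<open>\<delta> > 0\<close> by (simp add: field_simps)
      also have "\<dots> \<le> (\<delta> / 3) * g i" using M i \<open>\<delta> > 0\<close> by (intro mult_left_mono) auto
      finally have "l i * D \<le> l i * ((\<delta> / 3) * g i)" by (intro mult_left_mono) auto
      also have "\<dots> = (\<delta> / 3) * (l i * g i)" by simp
      also have "\<dots> \<le> (\<delta> / 3) * N i"
      proof -
        have "l i * g i \<le> N i" using g(1)[of i] N_ge[of i] by (simp add: l_def)
        hence "real (l i * g i) \<le> real (N i)" by (simp only: of_nat_le_iff)
        thus ?thesis using \<open>\<delta> > 0\<close> by (intro mult_left_mono) auto
      qed
      finally have 1: "l i * D \<le> (\<delta> / 3) * N i" .
      have "R J \<le> (\<delta> / 3) * k" using k \<open>\<delta> > 0\<close> by (simp add: field_simps)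
      also have "\<dots> \<le> (\<delta> / 3) * N i" using N_ge[of i] i \<open>\<delta> > 0\<close> by (intro mult_left_mono) auto
      finally have 2: "R J \<le> (\<delta> / 3) * N i" .
      have "R i = R J + (\<Sum>j=J..<i. l j * \<eta> j)"
        using i by (simp add: R_def lessThan_atLeast0 sum.atLeastLessThan_concat)
      also have "(\<Sum>j=J..<i. l j * \<eta> j) \<le> (\<Sum>j=J..<i. l j * (\<delta> / 3))"
        using J by (intro sum_mono mult_left_mono) auto
      also have "\<dots> \<le> (\<Sum>j<i. l j * (\<delta> / 3))"
        by (rule sum_mono2) (use \<open>\<delta> > 0\<close> in auto)
      also have "\<dots> = (\<delta> / 3) * N i"
        by (simp add: N_def sum_distrib_left mult.commute)
      finally have 3: "R i \<le> R J + (\<delta> / 3) * N i" by simp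
      show ?thesis using 1 2 3 by simp
    qed
    thus ?thesis by blast
  qed
  have "\<exists>x. \<forall>i. pre (l i) ((shift ^^ N i) x) = e (g i) (pre (p i) ((shift ^^ Q i) v))" for v
    unfolding N_def by (rule ex_infinite_concatenation) (use code in \<open>auto simp: l_def p_def\<close>)
  then obtain \<Psi> where \<Psi>: "\<And>v i. pre (l i) ((shift ^^ N i) (\<Psi> v)) = e (g i) (pre (p i) ((shift ^^ Q i) v))"
    by metis

  have "(\<lambda>n. bsum f n (\<Psi> v) / n) \<longlonglongrightarrow> \<alpha>" for v
  proof (rule tendstoI)
    fix \<delta> :: real assume \<delta>: "\<delta> > 0"
    define x where "x = \<Psi> v"
    have block: "\<bar>bsum f (N i) x - N i * \<alpha>\<bar> \<le> R i" for i
    proof (induction i)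
      case (Suc i)
      have "\<bar>bsum f (l i) ((shift ^^ N i) x) - l i * \<alpha>\<bar> \<le> l i * \<eta> i"
        unfolding l_def \<eta>_def
        by (rule code(5)[of "pre (p i) ((shift ^^ Q i) v)"]) (use \<Psi>[of i v] in \<open>simp_all add: p_def l_def x_def\<close>)
      moreover have "R (Suc i) = R i + l i * \<eta> i" by (simp add: R_def)
      ultimately show ?case using Suc
        unfolding N_Suc bsum_add of_nat_add distrib_right by linarith
    qed (simp add: N_0 bsum_def R_def)
    \<comment> \<open>Inside an unfinished block each step contributes at most
      \<open>B + \<bar>\<alpha>\<bar>\<close> to the deviation.\<close>
    define D where "D = B + \<bar>\<alpha>\<bar>"
    have "D > 0" using B(1) by (simp add: D_def)
    then obtain I where I: "\<And>i. i \<ge> I \<Longrightarrow> R i + l i * D \<le> (\<delta> / 2) * N i"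
      using error[OF half_gt_zero[OF \<delta>]] by blast
    have "\<bar>bsum f m x / m - \<alpha>\<bar> < \<delta>" if m: "m \<ge> N I" "m \<ge> 1" for m
    proof -
      obtain i where i: "N i \<le> m" "m < N (Suc i)"
        using ex_interval_index[of N m] N_0 N_ge[of "Suc m"] by (auto simp: less_eq_Suc_le)
      have "I \<le> i" using N_mono[of "Suc i" I] m(1) i(2) by (meson leD le_trans not_less_eq_eq)
      define k where "k = m - N i"
      have k: "m = N i + k" "k \<le> l i" using i by (simp_all add: k_def N_Suc)
      have "\<bar>bsum f k ((shift ^^ N i) x)\<bar> \<le> k * B" by (rule abs_bsum_le[OF B(2)])
      moreover have "\<bar>k * \<alpha>\<bar> = k * \<bar>\<alpha>\<bar>" by (simp add: abs_mult)
      moreover have "k * B + k * \<bar>\<alpha>\<bar> \<le> l i * D"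
        using k(2) B(1) by (simp add: D_def mult_right_mono flip: distrib_left)
      ultimately have "\<bar>bsum f m x - m * \<alpha>\<bar> \<le> R i + l i * D"
        using block[of i] unfolding k(1) bsum_add of_nat_add distrib_right by linarith
      also have "\<dots> \<le> (\<delta> / 2) * N i" by (rule I[OF \<open>I \<le> i\<close>])
      also have "\<dots> \<le> (\<delta> / 2) * m" using i(1) \<delta> by (intro mult_left_mono) auto
      also have "\<dots> < \<delta> * m" using \<delta> m(2) by simp
      finally have "\<bar>bsum f m x - m * \<alpha>\<bar> / m < \<delta>" using m(2) by (simp add: divide_less_eq)
      moreover have "bsum f m x / m - \<alpha> = (bsum f m x - m * \<alpha>) / m"
        using m(2) by (simp add: field_simps)
      ultimately show ?thesis by simp
    qed
    thus "\<forall>\<^sub>F m in sequentially. dist (bsum f m (\<Psi> v) / m) \<alpha> < \<delta>"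
      unfolding eventually_sequentially dist_real_def x_def
      by (intro exI[of _ "max 1 (N I)"]) auto
  qed
  hence range: "range \<Psi> \<subseteq> {w. (\<lambda>n. bsum f n w / n) \<longlonglongrightarrow> \<alpha>}" by blast

  \<comment> \<open>This choice turns \<open>h * N i - R i \<le> Q i\<close> into
    \<open>s * N (Suc i) \<le> Q i\<close> for i from I on; the constant c below absorbs the
    finitely many earlier blocks.\<close>
  obtain I where I: "\<And>i. i \<ge> I \<Longrightarrow> R i + l i * s \<le> (h - s) * N i"
    using error[of "h - s" s] s by (meson diff_gt_0_iff_gt)
  define c where "c = s * N (Suc I)"
  have Q: "s * N (Suc i) - c \<le> Q i" for i
  proof (cases "i \<ge> I")
    case True
    have "h * N i - R i = (\<Sum>j<i. l j * (h - \<eta> j))"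
      by (simp add: N_def R_def sum_distrib_left sum_subtractf right_diff_distrib mult.commute)
    also have "\<dots> \<le> (\<Sum>j<i. real (p j))"
      using code(3) by (intro sum_mono) (auto simp: l_def p_def \<eta>_def)
    also have "\<dots> = Q i" by (simp add: Q_def)
    finally have "h * N i - R i \<le> Q i" .
    moreover have "c \<ge> 0" using s by (simp add: c_def)
    ultimately show ?thesis using I[OF True] by (simp add: N_Suc algebra_simps)
  next
    case False
    have "s * N (Suc i) \<le> c"
      unfolding c_def using N_mono[of "Suc i" "Suc I"] False s by (intro mult_left_mono) auto
    thus ?thesis by linarith
  qed
  show ?thesis
  proof (rule hausdorff_dim_ge_holder[OF s(1) _ _ range])
    show "2 powr c > 0" by simp
    fix v w :: binseq
    show "dist v w \<le> 2 powr c * dist (\<Psi> v) (\<Psi> w) powr s"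
    proof (cases "v = w")
      case False
      then obtain r' where "digit v r' \<noteq> digit w r'" by (auto simp: binseq_eq_iff)
      \<comment> \<open>The first disagreement of v and w lies in some source block i. Injectivity
        of the code carries it into image block i, hence before position \<open>N (Suc i)\<close>,
        while \<open>Q i \<le> r\<close>.\<close>
      define r where "r = (LEAST r. digit v r \<noteq> digit w r)"
      have r: "digit v r \<noteq> digit w r" unfolding r_def by (rule LeastI) fact
      have r_min: "digit v k = digit w k" if "k < r" for k
        using not_less_Least[of k "\<lambda>r. digit v r \<noteq> digit w r"] that by (auto simp: r_def)
      \<comment> \<open>Source blocks may be empty, so unboundedness of Q comes from its linear
        lower bound.\<close>
      have "\<exists>i. r < Q (Suc i)"
      proof -
        obtain i :: nat where "(r + c + 1) / s \<le> i" using real_arch_simple by blast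
        hence "r + c + 1 \<le> s * i" using s by (simp add: field_simps)
        also have "\<dots> \<le> s * N (Suc (Suc i))"
          using N_ge[of "Suc (Suc i)"] s by (intro mult_left_mono) auto
        finally show ?thesis using Q[of "Suc i"] by (intro exI[of _ i]) linarith
      qed
      then obtain i where i: "Q i \<le> r" "r < Q (Suc i)"
        using ex_interval_index[of Q r] by (auto simp: Q_def)
      have "r - Q i < p i" using i by (simp add: Q_def)
      moreover have "digit ((shift ^^ Q i) v) (r - Q i) \<noteq> digit ((shift ^^ Q i) w) (r - Q i)"
        using r i(1) by simp
      ultimately have "pre (p i) ((shift ^^ Q i) v) \<noteq> pre (p i) ((shift ^^ Q i) w)"
        unfolding pre_eq_iff by blast
      hence "pre (l i) ((shift ^^ N i) (\<Psi> v)) \<noteq> pre (l i) ((shift ^^ N i) (\<Psi> w))"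
        unfolding \<Psi> by (subst inj_on_eq_iff[OF code(2)]) (simp_all add: p_def)
      then obtain k where k: "k < l i" "digit (\<Psi> v) (N i + k) \<noteq> digit (\<Psi> w) (N i + k)"
        by (auto simp: pre_eq_iff)
      have "(1/2) ^ N (Suc i) \<le> (1/2::real) ^ Suc (N i + k)"
        by (rule power_decreasing) (use k(1) in \<open>auto simp: N_Suc\<close>)
      also have "\<dots> \<le> dist (\<Psi> v) (\<Psi> w)"
        using dist_binseq_ge[OF k(2)] by (simp add: power_one_over)
      finally have ge: "2 powr - real (N (Suc i)) \<le> dist (\<Psi> v) (\<Psi> w)"
        by (simp add: powr_minus_divide powr_realpow power_one_over)
      have "dist v w \<le> 1 / 2 ^ r" by (rule dist_binseq_le[OF r_min])
      also have "\<dots> = 2 powr (- real r)" by (simp add: powr_minus_divide powr_realpow)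
      also have "\<dots> \<le> 2 powr (c + (- real (N (Suc i)) * s))"
        using i(1) Q[of i] by (simp add: mult.commute)
      also have "\<dots> = 2 powr c * (2 powr - real (N (Suc i))) powr s"
        by (simp add: powr_powr flip: powr_add)
      also have "\<dots> \<le> 2 powr c * dist (\<Psi> v) (\<Psi> w) powr s"
        using ge s by (intro mult_left_mono powr_mono2) auto
      finally show ?thesis .
    qed simp
  qed
qed

section \<open>Continuity from behaviour at the end points\<close>

lemma hausdorff_dim_level:
  "hausdorff_dim {w. (\<lambda>n. bsum (apply_bcontfun f) n w / n) \<longlonglongrightarrow> \<alpha>} = ennreal (birkhoff_spectrum f \<alpha>)"
proof -
  have "hausdorff_dim (birkhoff_level f \<alpha>) < top"
    using hausdorff_dim_binseq_le_1[of "birkhoff_level f \<alpha>"] by (simp add: order_le_less_trans)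
  thus ?thesis
    unfolding birkhoff_spectrum_def birkhoff_level_altdef by (simp add: ennreal_enn2real)
qed

lemma birkhoff_spectrum_nonneg: "0 \<le> birkhoff_spectrum f \<alpha>"
  by (simp add: birkhoff_spectrum_def enn2real_nonneg)

lemma hausdorff_dim_empty: "hausdorff_dim ({} :: binseq set) = 0"
proof -
  have small: "hausdorff_dim ({} :: binseq set) \<le> ennreal s" if "s > 0" for s
    by (rule hausdorff_dim_le_cylinders[where s' = 0 and G = "\<lambda>_. {}" and K = 0]) (use that in auto)
  have "hausdorff_dim ({} :: binseq set) \<le> 0"
    by (rule ennreal_le_epsilon) (simp add: small)
  thus ?thesis by simp
qed

lemma birkhoff_spectrum_eq_0:
  assumes "\<not> rate (apply_bcontfun f) \<alpha> 0"
  shows "birkhoff_spectrum f \<alpha> = 0"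
proof -
  have "birkhoff_level f \<alpha> = {}"
    using assms rate_0_if_level[OF continuous_on_apply_bcontfun] unfolding birkhoff_level_altdef by blast
  thus ?thesis by (simp add: birkhoff_spectrum_def hausdorff_dim_empty)
qed

text \<open>Together with \<open>birkhoff_spectrum_ge_rate\<close> this identifies the spectrum with
  the largest rate, wherever rate 0 is available.\<close>

lemma rate_birkhoff_spectrum:
  assumes "rate (apply_bcontfun f) \<alpha> 0"
  shows "rate (apply_bcontfun f) \<alpha> (birkhoff_spectrum f \<alpha>)"
proof (rule rate_closed)
  fix \<epsilon> :: real assume \<epsilon>: "\<epsilon> > 0"
  show "\<exists>\<beta> s. \<bar>\<beta> - \<alpha>\<bar> \<le> \<epsilon> \<and> birkhoff_spectrum f \<alpha> - \<epsilon> \<le> s \<and> rate (apply_bcontfun f) \<beta> s"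
  \<comment> \<open>Dimension yields rates only for positive exponents; otherwise the assumed rate 0
    is already large enough.\<close>
  proof (cases "birkhoff_spectrum f \<alpha> - \<epsilon> \<le> 0")
    case True
    thus ?thesis using assms \<epsilon> by (intro exI[of _ \<alpha>] exI[of _ 0]) auto
  next
    case False
    have "rate (apply_bcontfun f) \<alpha> (birkhoff_spectrum f \<alpha> - \<epsilon>)"
      by (rule rate_if_dim_level_gt) (use False \<epsilon> in \<open>auto simp: hausdorff_dim_level ennreal_less_iff\<close>)
    thus ?thesis using \<epsilon> by (intro exI[of _ \<alpha>] exI[of _ "birkhoff_spectrum f \<alpha> - \<epsilon>"]) auto
  qed
qed

lemma birkhoff_spectrum_ge_rate:
  assumes "rate (apply_bcontfun f) \<alpha> h"
  shows "h \<le> birkhoff_spectrum f \<alpha>"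
proof (rule dense_le)
  fix s assume "s < h"
  show "s \<le> birkhoff_spectrum f \<alpha>"
  proof (cases "s > 0")
    case True
    have "ennreal s \<le> ennreal (birkhoff_spectrum f \<alpha>)"
      unfolding hausdorff_dim_level[symmetric]
      by (rule dim_level_ge_if_rate[OF _ assms True \<open>s < h\<close>]) simp
    thus ?thesis using birkhoff_spectrum_nonneg by (simp add: ennreal_le_iff)
  next
    case False
    thus ?thesis using birkhoff_spectrum_nonneg[of f \<alpha>] by linarith
  qed
qed

lemma convex_rate_0: "convex {\<alpha>. rate f \<alpha> 0}"
  unfolding convex_def
proof (clarify)
  fix x y u v :: real
  assume "rate f x 0" "rate f y 0" "0 \<le> u" "0 \<le> v" "u + v = 1"
  thus "rate f (u *\<^sub>R x + v *\<^sub>R y) 0"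
    using rate_concave[of f x 0 y 0 u] by (simp add: eq_diff_eq[symmetric] add.commute)
qed

lemma closed_rate_0: "closed {\<alpha>. rate f \<alpha> 0}"
  unfolding closed_sequential_limits
proof (intro allI impI, elim conjE)
  fix x :: "nat \<Rightarrow> real" and \<alpha> assume x: "\<forall>n. x n \<in> {\<alpha>. rate f \<alpha> 0}" "x \<longlonglongrightarrow> \<alpha>"
  have "rate f \<alpha> 0"
  proof (rule rate_closed)
    fix \<epsilon> :: real assume \<epsilon>: "\<epsilon> > 0"
    obtain n where "dist (x n) \<alpha> < \<epsilon>"
      using eventually_happens'[OF sequentially_bot tendstoD[OF x(2) \<epsilon>]] by blast
    thus "\<exists>\<beta> s. \<bar>\<beta> - \<alpha>\<bar> \<le> \<epsilon> \<and> 0 - \<epsilon> \<le> s \<and> rate f \<beta> s"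
      using x(1) \<epsilon> by (intro exI[of _ "x n"] exI[of _ 0]) (auto simp: dist_real_def)
  qed
  thus "\<alpha> \<in> {\<alpha>. rate f \<alpha> 0}" by simp
qed

text \<open>Largest rates inherit concavity from the mixing of words; the sign turns this into
  convexity.\<close>

lemma convex_on_spectrum:
  "convex_on {\<alpha>. rate (apply_bcontfun f) \<alpha> 0} (\<lambda>\<alpha>. - birkhoff_spectrum f \<alpha>)"
proof (rule convex_onI[OF _ convex_rate_0])
  fix t x y :: real
  assume t: "0 < t" "t < 1" and xy: "x \<in> {\<alpha>. rate (apply_bcontfun f) \<alpha> 0}" "y \<in> {\<alpha>. rate (apply_bcontfun f) \<alpha> 0}"
  have "rate (apply_bcontfun f) ((1 - t) * x + (1 - (1 - t)) * y)
          ((1 - t) * birkhoff_spectrum f x + (1 - (1 - t)) * birkhoff_spectrum f y)"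
    by (rule rate_concave) (use t xy rate_birkhoff_spectrum in auto)
  thus "- birkhoff_spectrum f ((1 - t) *\<^sub>R x + t *\<^sub>R y)
      \<le> (1 - t) * - birkhoff_spectrum f x + t * - birkhoff_spectrum f y"
    using birkhoff_spectrum_ge_rate by fastforce
qed

text \<open>Smallness of the spectrum near and beyond the right end of the set of \<gamma> of rate
  0. Quantifying over all upper bounds \<beta> avoids naming its supremum.\<close>

definition thin_top :: "real \<Rightarrow> (binseq \<Rightarrow>\<^sub>C real) \<Rightarrow> bool" where
  "thin_top \<delta> f \<longleftrightarrow> (\<exists>\<epsilon>>0. \<forall>\<alpha> \<beta>. (\<forall>\<gamma>. rate (apply_bcontfun f) \<gamma> 0 \<longrightarrow> \<gamma> \<le> \<beta>) \<and> \<beta> - \<epsilon> \<le> \<alpha>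
      \<longrightarrow> birkhoff_spectrum f \<alpha> \<le> \<delta>)"

text \<open>On a neighbourhood of \<alpha>, including \<alpha> itself, the nonnegative spectrum is
  at most \<open>1 / Suc n\<close>, for every n.\<close>

lemma isCont_spectrum_top:
  assumes thin: "\<And>n. thin_top (1 / Suc n) f"
    and top: "\<forall>\<gamma>. rate (apply_bcontfun f) \<gamma> 0 \<longrightarrow> \<gamma> \<le> \<alpha>"
  shows "isCont (birkhoff_spectrum f) \<alpha>"
  unfolding isCont_def
proof (rule LIM_I)
  fix r :: real assume "r > 0"
  then obtain n where n: "1 / real (Suc n) < r" using nat_approx_posE by blast
  obtain \<epsilon> where \<epsilon>: "\<epsilon> > 0" "\<And>\<alpha>'. \<alpha> - \<epsilon> \<le> \<alpha>' \<Longrightarrow> birkhoff_spectrum f \<alpha>' \<le> 1 / Suc n"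
    using thin[of n] top unfolding thin_top_def by blast
  have "\<bar>birkhoff_spectrum f x - birkhoff_spectrum f \<alpha>\<bar> < r" if "\<bar>x - \<alpha>\<bar> < \<epsilon>" for x
    using \<epsilon>(2)[of x] \<epsilon>(2)[of \<alpha>] \<epsilon>(1) that n birkhoff_spectrum_nonneg[of f x] birkhoff_spectrum_nonneg[of f \<alpha>]
    by linarith
  thus "\<exists>s>0. \<forall>x. x \<noteq> \<alpha> \<and> norm (x - \<alpha>) < s \<longrightarrow> norm (birkhoff_spectrum f x - birkhoff_spectrum f \<alpha>) < r"
    using \<epsilon>(1) by (intro exI[of _ \<epsilon>]) auto
qed

lemma birkhoff_spectrum_uminus: "birkhoff_spectrum (- f) (- \<alpha>) = birkhoff_spectrum f \<alpha>"
proof -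
  have "bsum (apply_bcontfun (- f)) n w / n = - (bsum (apply_bcontfun f) n w / n)" for n w
    by (simp add: bsum_def sum_negf)
  hence "birkhoff_level (- f) (- \<alpha>) = birkhoff_level f \<alpha>"
    unfolding birkhoff_level_altdef by (simp add: tendsto_minus_cancel_left)
  thus ?thesis by (simp add: birkhoff_spectrum_def)
qed

lemma continuous_spectrum:
  assumes thin: "\<And>n. thin_top (1 / Suc n) f" "\<And>n. thin_top (1 / Suc n) (- f)"
  shows "continuous_on UNIV (birkhoff_spectrum f)"
  unfolding continuous_on_eq_continuous_at[OF open_UNIV]
proof (intro ballI)
  fix \<alpha>
  define L where "L = {\<alpha>. rate (apply_bcontfun f) \<alpha> 0}"
  consider "\<alpha> \<in> - L" | "\<alpha> \<in> interior L" | "\<alpha> \<in> L" "\<alpha> \<notin> interior L" by blast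
  thus "isCont (birkhoff_spectrum f) \<alpha>"
  proof cases
    case 1
    have op: "open (- L)" unfolding L_def using closed_rate_0 by (simp add: open_closed)
    have "continuous_on (- L) (birkhoff_spectrum f) \<longleftrightarrow> continuous_on (- L) (\<lambda>_. 0 :: real)"
      by (rule continuous_on_cong) (auto simp: L_def birkhoff_spectrum_eq_0)
    thus ?thesis using op 1 by (simp add: continuous_on_eq_continuous_at)
  next
    case 2
    have "convex_on (interior L) (\<lambda>\<alpha>. - birkhoff_spectrum f \<alpha>)"
      unfolding L_def
      by (rule convex_on_subset[OF convex_on_spectrum interior_subset convex_interior[OF convex_rate_0]])
    hence "continuous_on (interior L) (\<lambda>\<alpha>. - birkhoff_spectrum f \<alpha>)"
      by (intro convex_on_continuous open_interior)
    hence "continuous_on (interior L) (\<lambda>\<alpha>. - (- birkhoff_spectrum f \<alpha>))"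
      by (rule continuous_on_minus)
    thus ?thesis using 2 by (simp add: continuous_on_eq_continuous_at)
  next
    case 3
    \<comment> \<open>L is an interval, so with points on both sides of \<alpha> it would contain a
      neighbourhood of \<alpha>.\<close>
    have "(\<forall>\<gamma>\<in>L. \<gamma> \<le> \<alpha>) \<or> (\<forall>\<gamma>\<in>L. \<alpha> \<le> \<gamma>)"
    proof (rule ccontr)
      assume "\<not> ?thesis"
      then obtain a b where ab: "a \<in> L" "b \<in> L" "a < \<alpha>" "\<alpha> < b" by (auto simp: not_le)
      have "is_interval L"
        unfolding L_def is_interval_convex_1 by (rule convex_rate_0)
      hence "{a<..<b} \<subseteq> L"
        using ab(1,2) unfolding is_interval_1 by (meson greaterThanLessThan_iff less_imp_le subsetI)
      hence "{a<..<b} \<subseteq> interior L" by (rule interior_maximal) simp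
      with ab(3,4) 3(2) show False by auto
    qed
    thus ?thesis
    proof
      assume "\<forall>\<gamma>\<in>L. \<gamma> \<le> \<alpha>"
      thus ?thesis by (intro isCont_spectrum_top thin) (simp add: L_def)
    next
      \<comment> \<open>A left end point of L is a right end point for -f after reflection.\<close>
      assume *: "\<forall>\<gamma>\<in>L. \<alpha> \<le> \<gamma>"
      have "rate (apply_bcontfun f) (- \<gamma>) 0" if "rate (apply_bcontfun (- f)) \<gamma> 0" for \<gamma>
        using rate_uminus[OF that] by simp
      hence "\<forall>\<gamma>. rate (apply_bcontfun (- f)) \<gamma> 0 \<longrightarrow> \<gamma> \<le> - \<alpha>"
        using * by (metis L_def le_minus_iff mem_Collect_eq)
      hence "isCont (birkhoff_spectrum (- f)) (- \<alpha>)"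
        by (intro isCont_spectrum_top thin)
      hence "isCont (\<lambda>x. birkhoff_spectrum (- f) (- x)) \<alpha>"
        by (rule isCont_o2[OF isCont_minus[OF continuous_ident]])
      thus ?thesis by (simp add: birkhoff_spectrum_uminus)
    qed
  qed
qed

section \<open>Generic behaviour at the end points\<close>

lemma nowhere_denseI:
  fixes S :: "'a::metric_space set"
  assumes "\<And>x e. e > 0 \<Longrightarrow> \<exists>y r. r > 0 \<and> dist y x < e \<and> (\<forall>z. dist z y < r \<longrightarrow> z \<notin> S)"
  shows "nowhere_dense S"
  unfolding nowhere_dense_def
proof (rule ccontr)
  assume "interior (closure S) \<noteq> {}"
  then obtain x where "x \<in> interior (closure S)" by blast
  then obtain e where e: "e > 0" "ball x e \<subseteq> closure S" by (auto simp: mem_interior)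
  obtain y r where y: "r > 0" "dist y x < e" "\<And>z. dist z y < r \<Longrightarrow> z \<notin> S"
    using assms[OF e(1)] by blast
  have "y \<in> closure S" using y(2) e(2) by (auto simp: dist_commute)
  then obtain z where "z \<in> S" "dist z y < r" using y(1) unfolding closure_approachable by blast
  thus False using y(3) by blast
qed

lemma nowhere_dense_subset: "nowhere_dense T \<Longrightarrow> S \<subseteq> T \<Longrightarrow> nowhere_dense S"
  unfolding nowhere_dense_def using interior_mono[OF closure_mono[of S T]] by blast

section \<open>Counting words with few mismatches\<close>

lemma card_image_le_factor:
  assumes "finite (g ` A)" "\<And>x y. x \<in> A \<Longrightarrow> y \<in> A \<Longrightarrow> g x = g y \<Longrightarrow> f x = f y"
  shows "card (f ` A) \<le> card (g ` A)"
proof -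
  have "f ` A \<subseteq> (\<lambda>z. f (inv_into A g z)) ` g ` A"
  proof
    fix z assume "z \<in> f ` A"
    then obtain x where x: "x \<in> A" "z = f x" by blast
    have "f x = f (inv_into A g (g x))"
      using x by (intro assms(2)) (auto simp: f_inv_into_f inv_into_into)
    thus "z \<in> (\<lambda>z. f (inv_into A g z)) ` g ` A" using x by blast
  qed
  hence "card (f ` A) \<le> card ((\<lambda>z. f (inv_into A g z)) ` g ` A)"
    using assms(1) by (intro card_mono) auto
  also have "\<dots> \<le> card (g ` A)" using assms(1) by (rule card_image_le)
  finally show ?thesis .
qed

text \<open>A Chernoff-type bound: weighting each subset S by \<open>x ^ card S\<close>, the small
  subsets have weight at least \<open>x powr (n * \<theta>)\<close>, while all subsets together have
  weight \<open>(1 + x) ^ n\<close>.\<close>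

lemma card_small_subsets_le:
  fixes x \<theta> :: real
  assumes "0 < x" "x \<le> 1"
  shows "card {S \<in> Pow {..<n}. card S \<le> n * \<theta>} \<le> (1 + x) ^ n * x powr (- (n * \<theta>))"
proof -
  have "card {S \<in> Pow {..<n}. card S \<le> n * \<theta>} * x powr (n * \<theta>)
      = (\<Sum>S\<in>{S \<in> Pow {..<n}. card S \<le> n * \<theta>}. x powr (n * \<theta>))" by simp
  also have "\<dots> \<le> (\<Sum>S\<in>{S \<in> Pow {..<n}. card S \<le> n * \<theta>}. x ^ card S)"
  proof (rule sum_mono)
    fix S assume "S \<in> {S \<in> Pow {..<n}. card S \<le> n * \<theta>}"
    hence "x powr (n * \<theta>) \<le> x powr real (card S)"
      using assms by (intro powr_mono') auto
    thus "x powr (n * \<theta>) \<le> x ^ card S" using assms by (simp add: powr_realpow)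
  qed
  also have "\<dots> \<le> (\<Sum>S\<in>Pow {..<n}. x ^ card S)"
    using assms by (intro sum_mono2) auto
  also have "\<dots> = (1 + x) ^ n"
    using prod_add[of "{..<n}" "\<lambda>_. x" "\<lambda>_. 1"] by (simp add: add.commute)
  finally show ?thesis using assms by (simp add: powr_minus field_simps)
qed

definition mismatches :: "nat \<Rightarrow> nat \<Rightarrow> binseq \<Rightarrow> nat set" where
  "mismatches p n w = {i. i < n \<and> digit w i \<noteq> digit w (i + p)}"

text \<open>Over a binary alphabet a digit is determined by the one p places earlier and by whether
  the two differ.\<close>

lemma pre_eq_if_mismatches_eq:
  assumes "p \<ge> 1" "pre p w = pre p v" "mismatches p n w = mismatches p n v"
  shows "pre n w = pre n v"
proof -
  have "digit w k = digit v k" if "k < n" for k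
    using that
  proof (induction k rule: less_induct)
    case (less k)
    show ?case
    proof (cases "k < p")
      case True
      thus ?thesis using assms(2) by (simp add: pre_eq_iff)
    next
      case False
      define i where "i = k - p"
      have i: "k = i + p" "i < k" "i < n" using False less.prems assms(1) by (auto simp: i_def)
      have "i \<in> mismatches p n w \<longleftrightarrow> i \<in> mismatches p n v" using assms(3) by simp
      moreover have "digit w i = digit v i" using less.IH[OF i(2,3)] .
      ultimately show ?thesis using i(3) unfolding i(1) mismatches_def by auto
    qed
  qed
  thus ?thesis by (simp add: pre_eq_iff)
qed

text \<open>The point is that \<theta> does not depend on p: the first p digits contribute only the
  constant factor \<open>2 ^ p\<close>, which does not affect the growth rate.\<close>

lemma dim_le_if_rare_mismatches:
  assumes "\<delta> > 0"
  shows "\<exists>\<theta>::real. \<theta> > 0 \<and> (\<forall>p\<ge>1. \<forall>A. A \<subseteq> {w. \<exists>N. \<forall>n\<ge>N. card (mismatches p n w) \<le> n * \<theta>}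
            \<longrightarrow> hausdorff_dim A \<le> ennreal \<delta>)"
proof -
  \<comment> \<open>Chosen so that both factors of the subset count, \<open>(1 + x) ^ n\<close> and
    \<open>x powr (- (n * \<theta>))\<close>, are at most \<open>2 powr (n * \<delta> / 4)\<close>;
    the cap 1/2 makes the logarithm of x negative.\<close>
  define x where "x = min (1/2) (2 powr (\<delta> / 4) - 1)"
  have "1 < 2 powr (\<delta> / 4)" using assms powr_less_mono[of 0 "\<delta> / 4" 2] by simp
  hence x: "0 < x" "x < 1" "1 + x \<le> 2 powr (\<delta> / 4)" by (auto simp: x_def)
  define \<theta> where "\<theta> = (\<delta> / 4) / (- log 2 x)"
  have lx: "log 2 x < 0" using x by simp
  have \<theta>: "\<theta> > 0" unfolding \<theta>_def using assms lx by (intro divide_pos_pos) auto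
  have x\<theta>: "x powr (- \<theta>) = 2 powr (\<delta> / 4)"
  proof -
    have "x powr (- \<theta>) = (2 powr log 2 x) powr (- \<theta>)" using x(1) by simp
    also have "\<dots> = 2 powr (\<delta> / 4)" unfolding powr_powr using lx by (simp add: \<theta>_def)
    finally show ?thesis .
  qed
  have "hausdorff_dim A \<le> ennreal \<delta>"
    if p: "p \<ge> 1" and A: "A \<subseteq> {w. \<exists>N. \<forall>n\<ge>N. card (mismatches p n w) \<le> n * \<theta>}" for p A
  proof (rule hausdorff_dim_le_cylinders[where G = "\<lambda>n. {w. card (mismatches p n w) \<le> n * \<theta>}"])
    show "\<delta> / 2 < \<delta>" using assms by simp
    show "A \<subseteq> {w. \<exists>N. \<forall>n\<ge>N. w \<in> {w. card (mismatches p n w) \<le> n * \<theta>}}" using A by simp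
    fix N
    show "\<exists>n\<ge>N. card (pre n ` {w. card (mismatches p n w) \<le> n * \<theta>}) \<le> 2 ^ p * 2 powr (n * (\<delta> / 2))"
    proof (intro exI[of _ N] conjI)
      let ?G = "{w. card (mismatches p N w) \<le> N * \<theta>}" and ?g = "\<lambda>w. (pre p w, mismatches p N w)"
      let ?T = "{u :: bool list. length u = p} \<times> {S \<in> Pow {..<N}. card S \<le> N * \<theta>}"
      have fin: "finite {u :: bool list. length u = p}"
        using finite_lists_length_eq[of "UNIV :: bool set" p] by simp
      have sub: "?g ` ?G \<subseteq> ?T" by (auto simp: mismatches_def)
      have T: "finite ?T" using fin by simp
      have "card (pre N ` ?G) \<le> card (?g ` ?G)"
        by (rule card_image_le_factor[OF finite_subset[OF sub T] pre_eq_if_mismatches_eq[OF p]]) simp_all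
      also have "\<dots> \<le> card ?T" by (rule card_mono[OF T sub])
      also have "\<dots> = 2 ^ p * card {S \<in> Pow {..<N}. card S \<le> N * \<theta>}"
        using card_lists_length_eq[of "UNIV :: bool set" p] by (simp add: card_cartesian_product)
      finally have "real (card (pre N ` ?G)) \<le> real (2 ^ p * card {S \<in> Pow {..<N}. card S \<le> N * \<theta>})"
        by (simp only: of_nat_le_iff)
      also have "\<dots> = 2 ^ p * real (card {S \<in> Pow {..<N}. card S \<le> N * \<theta>})" by simp
      also have "\<dots> \<le> 2 ^ p * ((1 + x) ^ N * x powr (- (N * \<theta>)))"
        using x by (intro mult_left_mono card_small_subsets_le) auto
      also have "\<dots> \<le> 2 ^ p * ((2 powr (\<delta> / 4)) ^ N * x powr (- (N * \<theta>)))"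
        using x by (intro mult_left_mono mult_right_mono power_mono) auto
      also have "x powr (- (N * \<theta>)) = (x powr (- \<theta>)) ^ N"
        using x by (simp add: powr_power mult.commute)
      also have "\<dots> = (2 powr (\<delta> / 4)) ^ N" unfolding x\<theta> ..
      also have "(2 powr (\<delta> / 4)) ^ N * (2 powr (\<delta> / 4)) ^ N = 2 powr (N * (\<delta> / 2))"
        by (simp add: powr_power algebra_simps flip: powr_add)
      finally show "card (pre N ` ?G) \<le> 2 ^ p * 2 powr (N * (\<delta> / 2))" .
    qed simp
  qed (rule assms)
  thus ?thesis using \<theta> by blast
qed

section \<open>Nearly maximizing periodic points\<close>

lemma bsum_periodic:
  assumes "(shift ^^ p) x = x"
  shows "bsum f (k * p) x = k * bsum f p x"
  by (induction k) (simp_all add: bsum_add assms algebra_simps, simp add: bsum_def)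

lemma rate_0_if_periodic:
  assumes f: "continuous_on UNIV f" and p: "p \<ge> 1" "(shift ^^ p) x = x"
  shows "rate f (bsum f p x / p) 0"
  unfolding rate_def
proof (intro allI impI)
  fix \<epsilon> :: real assume \<epsilon>: "\<epsilon> > 0"
  obtain N where N: "\<And>n w v. n \<ge> N \<Longrightarrow> pre n w = pre n v \<Longrightarrow> \<bar>bsum f n w - bsum f n v\<bar> \<le> n * \<epsilon>"
    using bsum_distortion[OF f \<epsilon>] by blast
  define n where "n = Suc N * p"
  have "Suc N * 1 \<le> n" unfolding n_def using p(1) by (rule mult_le_mono2)
  hence n: "n \<ge> N" "n \<ge> 1" by simp_all
  have "n * (bsum f p x / p) = bsum f n x"
    unfolding n_def bsum_periodic[OF p(2)] using p(1) by (simp add: field_simps)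
  hence "rich f n (n * (bsum f p x / p)) (n * \<epsilon>) (n * (0 - \<epsilon>))"
    unfolding rich_def using N[OF n(1)] \<epsilon> powr_mono[of "- (real n * \<epsilon>)" 0 2]
    by (intro exI[of _ "{pre n x}"]) auto
  thus "\<exists>n\<ge>1. rich f n (n * (bsum f p x / p)) (n * \<epsilon>) (n * (0 - \<epsilon>))" using n(2) by blast
qed

text \<open>M is the supremum of the averages over periodic orbits. It also nearly bounds long
  averages of arbitrary points, since repeating a prefix of length n gives a periodic point whose
  sum differs only by distortion.\<close>

lemma near_maximizing_periodic:
  assumes f: "continuous_on UNIV f" and \<rho>: "\<rho> > 0"
  shows "\<exists>M p x N. p \<ge> 1 \<and> (shift ^^ p) x = x \<and> M - \<rho> < bsum f p x / p \<and>
           (\<forall>n\<ge>N. \<forall>w. bsum f n w \<le> n * (M + \<rho>))"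
proof -
  define A where "A = {bsum f p x / p | p x. p \<ge> 1 \<and> (shift ^^ p) x = x}"
  obtain B where B: "B > 0" "\<And>w. \<bar>f w\<bar> \<le> B" using bounded_on_binseq[OF f] by blast
  have bdd: "bdd_above A"
  proof (rule bdd_aboveI)
    fix y assume "y \<in> A"
    then obtain p x where px: "y = bsum f p x / p" "p \<ge> 1" by (auto simp: A_def)
    have "bsum f p x \<le> p * B" using abs_bsum_le[of f B p x, OF B(2)] by linarith
    thus "y \<le> B" using px by (simp add: divide_le_eq mult.commute)
  qed
  have "shift (Binseq (\<lambda>_. False)) = Binseq (\<lambda>_. False)" by (simp add: binseq_eq_iff)
  hence "(shift ^^ 1) (Binseq (\<lambda>_. False)) = Binseq (\<lambda>_. False)" by simp
  hence "A \<noteq> {}" unfolding A_def by blast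
  then obtain y where "y \<in> A" "Sup A - \<rho> < y"
    using less_cSup_iff[OF _ bdd, of "Sup A - \<rho>"] \<rho> by auto
  then obtain p x where px: "p \<ge> 1" "(shift ^^ p) x = x" "Sup A - \<rho> < bsum f p x / p"
    by (auto simp: A_def)
  obtain N where N: "\<And>n w v. n \<ge> N \<Longrightarrow> pre n w = pre n v \<Longrightarrow> \<bar>bsum f n w - bsum f n v\<bar> \<le> n * \<rho>"
    using bsum_distortion[OF f \<rho>] by blast
  have "bsum f n w \<le> n * (Sup A + \<rho>)" if n: "n \<ge> N" for n w
  proof (cases "n = 0")
    case True
    thus ?thesis by (simp add: bsum_def)
  next
    case False
    define v where "v = Binseq (\<lambda>k. digit w (k mod n))"
    have "(shift ^^ n) v = v" by (simp add: binseq_eq_iff v_def)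
    moreover have "n \<ge> 1" using False by simp
    ultimately have "bsum f n v / n \<in> A" unfolding A_def by blast
    hence "bsum f n v / n \<le> Sup A" by (rule cSup_upper[OF _ bdd])
    hence "bsum f n v \<le> n * Sup A" using False by (simp add: divide_le_eq mult.commute)
    moreover have "pre n w = pre n v" by (simp add: pre_eq_iff v_def)
    hence "\<bar>bsum f n w - bsum f n v\<bar> \<le> n * \<rho>" by (rule N[OF n])
    ultimately show ?thesis unfolding distrib_left by linarith
  qed
  thus ?thesis using px by blast
qed

section \<open>Perturbation by a return indicator\<close>

lemma continuous_return_indicator:
  "continuous_on UNIV (\<lambda>w. of_bool (digit w 0 = digit w p) :: real)"
  unfolding continuous_on_iff
proof (intro ballI allI impI)
  fix w :: binseq and e :: real assume "e > 0"
  have eq: "digit v k = digit w k" if "dist v w < 1 / 2 ^ Suc p" "k \<le> p" for v k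
  proof (rule ccontr)
    assume "digit v k \<noteq> digit w k"
    hence "1 / 2 ^ Suc k \<le> dist v w" by (rule dist_binseq_ge)
    moreover have "1 / 2 ^ Suc p \<le> (1 / 2 ^ Suc k :: real)" using that(2) by (simp add: frac_le)
    ultimately show False using that(1) by linarith
  qed
  have "dist (of_bool (digit v 0 = digit v p)) (of_bool (digit w 0 = digit w p) :: real) < e"
    if "dist v w < 1 / 2 ^ Suc p" for v
    using eq[OF that, of 0] eq[OF that, of p] \<open>e > 0\<close> by simp
  thus "\<exists>d>0. \<forall>v\<in>UNIV. dist v w < d \<longrightarrow>
      dist (of_bool (digit v 0 = digit v p)) (of_bool (digit w 0 = digit w p) :: real) < e"
    by (intro exI[of _ "1 / 2 ^ Suc p"]) simp
qed

lemma bsum_return_indicator: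
  "bsum (\<lambda>w. of_bool (digit w 0 = digit w p)) n w = real n - card (mismatches p n w)"
proof -
  have "bsum (\<lambda>w. of_bool (digit w 0 = digit w p)) n w = (\<Sum>i<n. 1 - of_bool (i \<in> mismatches p n w))"
    unfolding bsum_def by (rule sum.cong) (auto simp: mismatches_def add.commute)
  also have "\<dots> = real n - (\<Sum>i<n. of_bool (i \<in> mismatches p n w))" by (simp add: sum_subtractf)
  also have "(\<Sum>i<n. of_bool (i \<in> mismatches p n w)) = real (card ({..<n} \<inter> mismatches p n w))"
    by (subst sum_of_bool_eq) (auto simp: Int_def)
  also have "{..<n} \<inter> mismatches p n w = mismatches p n w" by (auto simp: mismatches_def)
  finally show ?thesis .
qed

lemma bsum_add_scaleR:
  "bsum (apply_bcontfun (f + c *\<^sub>R g)) n w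
     = bsum (apply_bcontfun f) n w + c * bsum (apply_bcontfun g) n w"
  by (simp add: bsum_def sum.distrib sum_distrib_left)

lemma bsum_dist_le:
  assumes "dist g h \<le> r"
  shows "\<bar>bsum (apply_bcontfun g) n w - bsum (apply_bcontfun h) n w\<bar> \<le> n * r"
proof -
  have "\<bar>apply_bcontfun g v - apply_bcontfun h v\<bar> \<le> r" for v
    using dist_bounded[of g v h] assms by (simp add: dist_real_def)
  from abs_bsum_le[of "\<lambda>v. apply_bcontfun g v - apply_bcontfun h v", OF this, of n w]
  show ?thesis by (simp add: bsum_def sum_subtractf)
qed

text \<open>The added multiple of the indicator rewards the chosen periodic orbit at every step, so
  an orbit with average near the new maximum can forgo the reward only rarely. All estimates survive
  a perturbation of size \<rho>.\<close>

lemma thin_top_dense_open: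
  fixes f :: "binseq \<Rightarrow>\<^sub>C real"
  assumes \<delta>: "\<delta> > 0" and \<eta>: "\<eta> > 0"
  shows "\<exists>g r. r > 0 \<and> dist g f < \<eta> \<and> (\<forall>h. dist h g < r \<longrightarrow> thin_top \<delta> h)"
proof -
  obtain \<theta> :: real where \<theta>: "\<theta> > 0" "\<And>p A. p \<ge> 1 \<Longrightarrow> A \<subseteq> {w. \<exists>N. \<forall>n\<ge>N. card (mismatches p n w) \<le> n * \<theta>}
      \<Longrightarrow> hausdorff_dim A \<le> ennreal \<delta>"
    using dim_le_if_rare_mismatches[OF \<delta>] by blast
  \<comment> \<open>Makes \<open>6 * \<rho>\<close> equal to \<open>(\<eta> / 2) * \<theta>\<close>.
    This is possible before p is known because \<theta> is independent of p.\<close>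
  define \<rho> where "\<rho> = \<theta> * \<eta> / 12"
  have \<rho>: "\<rho> > 0" using \<theta> \<eta> by (simp add: \<rho>_def)
  obtain M p x N where px: "p \<ge> 1" "(shift ^^ p) x = x" "M - \<rho> < bsum (apply_bcontfun f) p x / p"
    and N: "\<And>n w. n \<ge> N \<Longrightarrow> bsum (apply_bcontfun f) n w \<le> n * (M + \<rho>)"
    using near_maximizing_periodic[OF continuous_on_apply_bcontfun \<rho>, of f] by blast
  define \<phi> :: "binseq \<Rightarrow>\<^sub>C real" where "\<phi> = Bcontfun (\<lambda>w. of_bool (digit w 0 = digit w p))"
  have \<phi>: "apply_bcontfun \<phi> = (\<lambda>w. of_bool (digit w 0 = digit w p))"
    unfolding \<phi>_def by (rule Bcontfun_inverse) (simp add: bcontfun_binseq_iff continuous_return_indicator)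
  define g where "g = f + (\<eta> / 2) *\<^sub>R \<phi>"
  have g: "bsum (apply_bcontfun g) n w
      = bsum (apply_bcontfun f) n w + (\<eta> / 2) * (real n - card (mismatches p n w))" for n w
    unfolding g_def bsum_add_scaleR \<phi> bsum_return_indicator ..
  have "norm \<phi> \<le> 1" by (rule norm_bound) (simp add: \<phi>)
  hence "(\<eta> / 2) * norm \<phi> \<le> (\<eta> / 2) * 1" using \<eta> by (intro mult_left_mono) auto
  hence gf: "dist g f < \<eta>" using \<eta> by (simp add: g_def dist_norm)
  have "thin_top \<delta> h" if "dist h g < \<rho>" for h
    unfolding thin_top_def
  proof (intro exI[of _ \<rho>] conjI allI impI \<rho>, elim conjE)
    fix \<alpha> \<beta> assume ub: "\<forall>\<gamma>. rate (apply_bcontfun h) \<gamma> 0 \<longrightarrow> \<gamma> \<le> \<beta>" and \<alpha>: "\<beta> - \<rho> \<le> \<alpha>"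
    have hg: "\<bar>bsum (apply_bcontfun h) n w - bsum (apply_bcontfun g) n w\<bar> \<le> n * \<rho>" for n w
      by (rule bsum_dist_le) (use that in simp)
    have "bsum (apply_bcontfun h) p x / p \<le> \<beta>"
      using ub rate_0_if_periodic[OF continuous_on_apply_bcontfun px(1,2)] by blast
    hence "bsum (apply_bcontfun h) p x \<le> p * \<beta>" using px(1) by (simp add: divide_le_eq mult.commute)
    moreover have "p * (M - \<rho>) < bsum (apply_bcontfun f) p x" using px by (simp add: less_divide_eq mult.commute)
    \<comment> \<open>The periodic point collects the full reward \<eta> / 2 at every step.\<close>
    moreover have "mismatches p p x = {}"
    proof -
      have "digit x (i + p) = digit x i" for i
        using arg_cong[OF px(2), of "\<lambda>v. digit v i"] by (simp add: add.commute)
      thus ?thesis by (simp add: mismatches_def)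
    qed
    ultimately have "p * (M - 2 * \<rho> + \<eta> / 2) \<le> p * \<beta>"
      using hg[of p x] g[of p x] by (simp add: algebra_simps)
    hence \<beta>: "M - 2 * \<rho> + \<eta> / 2 \<le> \<beta>" using px(1) by simp
    have "hausdorff_dim {w. (\<lambda>n. bsum (apply_bcontfun h) n w / n) \<longlonglongrightarrow> \<alpha>} \<le> ennreal \<delta>"
    proof (rule \<theta>(2)[OF px(1)], clarify)
      fix w assume "(\<lambda>n. bsum (apply_bcontfun h) n w / n) \<longlonglongrightarrow> \<alpha>"
      hence "\<forall>\<^sub>F n in sequentially. \<alpha> - \<rho> < bsum (apply_bcontfun h) n w / n"
        by (rule order_tendstoD(1)) (use \<rho> in simp)
      then obtain N' where N': "\<And>n. n \<ge> N' \<Longrightarrow> \<alpha> - \<rho> < bsum (apply_bcontfun h) n w / n"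
        unfolding eventually_sequentially by blast
      have "card (mismatches p n w) \<le> n * \<theta>" if n: "n \<ge> max 1 (max N N')" for n
      proof -
        have "n * (\<alpha> - \<rho>) < bsum (apply_bcontfun h) n w"
          using N'[of n] n by (simp add: less_divide_eq mult.commute)
        \<comment> \<open>Four \<rho> are lost below: near-maximality of x, passing from g to h, the
          distance from \<alpha> to \<beta>, and convergence. Two more come from the upper bound:
          the excess over M and passing from h to g.\<close>
        moreover have "n * (M - 4 * \<rho> + \<eta> / 2) \<le> n * (\<alpha> - \<rho>)"
          using \<alpha> \<beta> by (intro mult_left_mono) auto
        ultimately have "(\<eta> / 2) * card (mismatches p n w) \<le> n * (6 * \<rho>)"
          using hg[of n w] g[of n w] N[of n w] n by (simp add: algebra_simps)
        also have "\<dots> = (\<eta> / 2) * (n * \<theta>)" by (simp add: \<rho>_def)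
        finally show ?thesis using \<eta> by simp
      qed
      thus "\<exists>N. \<forall>n\<ge>N. card (mismatches p n w) \<le> n * \<theta>" by blast
    qed
    thus "birkhoff_spectrum h \<alpha> \<le> \<delta>" using \<delta> by (simp add: hausdorff_dim_level ennreal_le_iff)
  qed
  thus ?thesis using \<rho> gf by blast
qed

section \<open>The exceptional set as a countable union\<close>

lemma nowhere_dense_not_thin_top:
  assumes "\<delta> > 0"
  shows "nowhere_dense {f. \<not> thin_top \<delta> f}"
  by (rule nowhere_denseI) (use thin_top_dense_open[OF assms] in simp)

lemma nowhere_dense_not_thin_top_uminus:
  assumes "\<delta> > 0"
  shows "nowhere_dense {f. \<not> thin_top \<delta> (- f)}"
proof (rule nowhere_denseI)
  fix f :: "binseq \<Rightarrow>\<^sub>C real" and \<eta> :: real assume "\<eta> > 0"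
  then obtain g r where g: "r > 0" "dist g (- f) < \<eta>" "\<And>h. dist h g < r \<Longrightarrow> thin_top \<delta> h"
    using thin_top_dense_open[OF assms] by blast
  have "dist (- g) f < \<eta>" using g(2) dist_minus[of g "- f"] by simp
  moreover have "thin_top \<delta> (- h)" if "dist h (- g) < r" for h
    using g(3)[of "- h"] that dist_minus[of h "- g"] by simp
  ultimately show "\<exists>g r. 0 < r \<and> dist g f < \<eta> \<and> (\<forall>h. dist h g < r \<longrightarrow> h \<notin> {f. \<not> thin_top \<delta> (- f)})"
    using g(1) by blast
qed

lemma first_category_subset_UN:
  assumes "\<And>n. nowhere_dense (X n)" "\<And>n. nowhere_dense (Y n)" "S \<subseteq> (\<Union>n::nat. X n \<union> Y n)"
  shows "first_category S"
  unfolding first_category_def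
proof (intro exI conjI allI)
  \<comment> \<open>The two families are interleaved by parity, and intersected with S since
    \<open>first_category\<close> asks for an exact union.\<close>
  let ?T = "\<lambda>n. S \<inter> (if even n then X (n div 2) else Y (n div 2))"
  show "nowhere_dense (?T n)" for n
    using nowhere_dense_subset[OF assms(1)[of "n div 2"] Int_lower2]
      nowhere_dense_subset[OF assms(2)[of "n div 2"] Int_lower2]
    by (cases "even n") simp_all
  show "S = (\<Union>n. ?T n)"
  proof
    show "S \<subseteq> (\<Union>n. ?T n)"
    proof
      fix s assume s: "s \<in> S"
      then obtain n where "s \<in> X n \<or> s \<in> Y n" using assms(3) by blast
      hence "s \<in> ?T (2 * n) \<or> s \<in> ?T (2 * n + 1)" using s by simp
      thus "s \<in> (\<Union>n. ?T n)" by blast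
    qed
  qed auto
qed

theorem theorem4p2p1:
  shows "first_category {f :: binseq \<Rightarrow>\<^sub>C real. \<not> continuous_on UNIV (birkhoff_spectrum f)}"
proof (rule first_category_subset_UN)
  show "nowhere_dense {f. \<not> thin_top (1 / Suc n) f}" for n
    by (rule nowhere_dense_not_thin_top) simp
  show "nowhere_dense {f. \<not> thin_top (1 / Suc n) (- f)}" for n
    by (rule nowhere_dense_not_thin_top_uminus) simp
  show "{f :: binseq \<Rightarrow>\<^sub>C real. \<not> continuous_on UNIV (birkhoff_spectrum f)}
      \<subseteq> (\<Union>n. {f. \<not> thin_top (1 / Suc n) f} \<union> {f. \<not> thin_top (1 / Suc n) (- f)})"
    using continuous_spectrum by fastforce
qed

end
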